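(* Let $M^n$ be an $n$-dimensional Riemannian manifold with $\mathrm{Ric}_M\geq(n-1)k$, and let $\mathbb S^n_k$ be the simply connected and complete $n$-dimensional space form of constant curvature $k$. Let $\gamma:[0,l]\to M^n$ and $\tilde\gamma:[0,l]\to\mathbb S^n_k$ be normal geodesics. Let $V_i$ and $\tilde V_i$, $1\leq i\leq n-1$, be Jacobi fields along $\gamma$ and $\tilde\gamma$ respectively, with $\langle\gamma',V_i\rangle=\langle\tilde\gamma',\tilde V_i\rangle=0$ and $$0<\|V_1(0)\wedge\cdots\wedge V_{n-1}(0)\|\leq\|\tilde V_1(0)\wedge\cdots\wedge\tilde V_{n-1}(0)\|.$$ If $V_i'(0)=\lambda V_i(0)$ and $\tilde V_i'(0)=\tilde\lambda\tilde V_i(0)$ for all $i$, with real numbers $\lambda\leq\tilde\lambda$, and if there is no focal point of $\gamma(0)$ with respect to $\lambda\cdot\mathrm{id}$ on $\gamma$, then for all $t\in[0,l]$ $$\|\tilde V_1(t)\wedge\cdots\wedge\tilde V_{n-1}(t)\|\geq\|V_1(t)\wedge\cdots\wedge V_{n-1}(t)\|;$$ moreover, if the equality holds for some $t_0\in(0,l]$, then on $[0,t_0]$ each $\|V_i\|=\|\tilde V_i\|$, $\frac{V_i}{\|V_i\|}$ is a parallel vector field, $K(\gamma',V_i)=k$, and $\lambda=\tilde\lambda$.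
   Context: A normal geodesic is a geodesic parametrized by arc length. A prime on a vector field along a geodesic denotes covariant derivative along it. $\mathrm{Ric}_M\ge (n-1)k$ means $\mathrm{Ric}(v,v)\ge (n-1)k$ for all unit tangent vectors $v$. $K(X,Y)$ is the sectional curvature of the plane spanned by $X,Y$. $\|v_1\wedge\cdots\wedge v_{n-1}\|$ is the $(n-1)$-dimensional volume of the parallelepiped spanned by the vectors, i.e. $\sqrt{\det(\langle v_i,v_j\rangle)}$. Focal points: for a symmetric linear transformation $B$ on the tangent space $M_{\gamma(0)}$ and $t\in(0,l]$, $\gamma(t)$ is a focal point of $\gamma(0)$ with respect to $B$ on $\gamma$ if there is a Jacobi field $J$ along $\gamma|_{[0,t]}$ with $J(t)=0$, $0\neq J(0)\in M_{\gamma(0)}$ and $J'(0)=B(J(0))$. "No focal point of $\gamma(0)$ with respect to $B$ on $\gamma$" means that no $t\in(0,l]$ has this property. Here $\mathrm{id}$ is the identity of $M_{\gamma(0)}$.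
   Formalization: In the equality case, "each ‖V_i‖=‖Ṽ_i‖" is false for n≥3 (flat R³, λ=λ̃=0: V=(2e1,½e2), Ṽ=(e1,e2)); it is replaced by ‖V_i(t)‖/‖V_i(0)‖=‖Ṽ_i(t)‖/‖Ṽ_i(0)‖ on [0,t0]. Also n≥2 and l>0 are assumed. *)

theory Defs
  imports "HOL-Analysis.Analysis"
begin

section \<open>Smooth maps on open subsets of normed spaces\<close>

text \<open>Only meant for open \<open>S\<close> (and a finite-dimensional domain).\<close>

primrec Ck_on :: "nat \<Rightarrow> 'a::real_normed_vector set \<Rightarrow> ('a \<Rightarrow> 'b::real_normed_vector) \<Rightarrow> bool" where
  "Ck_on 0 S f \<longleftrightarrow> continuous_on S f"
| "Ck_on (Suc k) S f \<longleftrightarrow>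
     f differentiable_on S \<and> (\<forall>v. Ck_on k S (\<lambda>x. frechet_derivative f (at x) v))"

definition smooth_on :: "'a::real_normed_vector set \<Rightarrow> ('a \<Rightarrow> 'b::real_normed_vector) \<Rightarrow> bool" where
  "smooth_on S f \<longleftrightarrow> (\<forall>k. Ck_on k S f)"


section \<open>Riemannian manifolds\<close>

text \<open>
  The underlying space of a manifold is a whole type \<open>'m\<close>; its dimension is \<open>CARD('n)\<close>.
  A chart is a domain together with a coordinate map, whose values outside the domain are
  irrelevant. The metric is given by its component matrix in each chart \<open>c\<close>, as a function of the
  coordinates \<open>x \<in> coord c ` chart_dom c\<close>.
\<close>

type_synonym ('m, 'n) chart = "'m set \<times> ('m \<Rightarrow> real^'n)"

abbreviation chart_dom :: "('m, 'n) chart \<Rightarrow> 'm set" where "chart_dom \<equiv> fst"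
abbreviation coord :: "('m, 'n) chart \<Rightarrow> 'm \<Rightarrow> real^'n" where "coord \<equiv> snd"

record ('m, 'n) riem =
  atlas :: "('m, 'n) chart set"
  metric :: "('m, 'n) chart \<Rightarrow> real^'n \<Rightarrow> real^'n^'n"

definition chart_inv :: "('m, 'n) chart \<Rightarrow> real^'n \<Rightarrow> 'm" where
  "chart_inv c = inv_into (chart_dom c) (coord c)"

definition transition :: "('m, 'n) chart \<Rightarrow> ('m, 'n) chart \<Rightarrow> real^'n \<Rightarrow> real^'n" where
  "transition c d = coord d \<circ> chart_inv c"

definition charts_at :: "('m, 'n::finite) riem \<Rightarrow> 'm \<Rightarrow> ('m, 'n) chart set" where
  "charts_at G p = {c \<in> atlas G. p \<in> chart_dom c}"

definition metric_form :: "('m, 'n::finite) riem \<Rightarrow> ('m, 'n) chart \<Rightarrow> real^'n \<Rightarrow> real^'n \<Rightarrow> real^'n \<Rightarrow> real" where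
  "metric_form G c x u v = u \<bullet> (metric G c x *v v)"

definition smooth_atlas :: "('m::topological_space, 'n::finite) chart set \<Rightarrow> bool" where
  "smooth_atlas A \<longleftrightarrow>
     (\<Union>c\<in>A. chart_dom c) = UNIV \<and>
     (\<forall>c\<in>A. open (chart_dom c) \<and> open (coord c ` chart_dom c) \<and>
        homeomorphism (chart_dom c) (coord c ` chart_dom c) (coord c) (chart_inv c)) \<and>
     (\<forall>c\<in>A. \<forall>d\<in>A. smooth_on (coord c ` (chart_dom c \<inter> chart_dom d)) (transition c d))"

definition riemannian_manifold ::
    "('m::{t2_space, second_countable_topology}, 'n::finite) riem \<Rightarrow> bool" where
  "riemannian_manifold G \<longleftrightarrow>
     smooth_atlas (atlas G) \<and>
     (\<forall>c\<in>atlas G. smooth_on (coord c ` chart_dom c) (metric G c) \<and>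
        (\<forall>x\<in>coord c ` chart_dom c.
           (\<forall>u v. metric_form G c x u v = metric_form G c x v u) \<and>
           (\<forall>u. u \<noteq> 0 \<longrightarrow> metric_form G c x u u > 0))) \<and>
     (\<forall>p. \<forall>c\<in>charts_at G p. \<forall>d\<in>charts_at G p. \<forall>u v.
        metric_form G c (coord c p) u v =
        metric_form G d (coord d p)
          (frechet_derivative (transition c d) (at (coord c p)) u)
          (frechet_derivative (transition c d) (at (coord c p)) v))"


section \<open>Tangent vectors\<close>

text \<open>
  A tangent vector at \<open>p\<close> is the family of its components in all charts around \<open>p\<close>, subject to
  the usual transformation law. Components in the remaining charts are set to \<open>0\<close>, so that
  each vector has a unique representation and the vector space operations are pointwise.
\<close>

type_synonym ('m, 'n) tvec = "('m, 'n) chart \<Rightarrow> real^'n"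

definition tangent_space :: "('m, 'n::finite) riem \<Rightarrow> 'm \<Rightarrow> ('m, 'n) tvec set" where
  "tangent_space G p = {v.
     (\<forall>c. c \<notin> charts_at G p \<longrightarrow> v c = 0) \<and>
     (\<forall>c\<in>charts_at G p. \<forall>d\<in>charts_at G p.
        v d = frechet_derivative (transition c d) (at (coord c p)) (v c))}"

definition tzero :: "('m, 'n::finite) tvec" where
  "tzero = (\<lambda>_. 0)"

definition tadd :: "('m, 'n::finite) tvec \<Rightarrow> ('m, 'n) tvec \<Rightarrow> ('m, 'n) tvec" where
  "tadd u v = (\<lambda>c. u c + v c)"

definition tscale :: "real \<Rightarrow> ('m, 'n::finite) tvec \<Rightarrow> ('m, 'n) tvec" where
  "tscale a v = (\<lambda>c. a *\<^sub>R v c)"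

text \<open>Scalars are computed in one chart; for tangent vectors the choice is immaterial.\<close>

definition chart_at :: "('m, 'n::finite) riem \<Rightarrow> 'm \<Rightarrow> ('m, 'n) chart" where
  "chart_at G p = (SOME c. c \<in> charts_at G p)"

definition ip :: "('m, 'n::finite) riem \<Rightarrow> 'm \<Rightarrow> ('m, 'n) tvec \<Rightarrow> ('m, 'n) tvec \<Rightarrow> real" where
  "ip G p u v = (let c = chart_at G p in metric_form G c (coord c p) (u c) (v c))"

definition tnorm :: "('m, 'n::finite) riem \<Rightarrow> 'm \<Rightarrow> ('m, 'n) tvec \<Rightarrow> real" where
  "tnorm G p v = sqrt (ip G p v v)"

definition wedge_norm ::
    "('m, 'n::finite) riem \<Rightarrow> 'm \<Rightarrow> ('i::finite \<Rightarrow> ('m, 'n) tvec) \<Rightarrow> real" where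
  "wedge_norm G p v = sqrt (det (\<chi> i j. ip G p (v i) (v j)))"


section \<open>Levi-Civita connection and curvature\<close>

text \<open>
  \<open>christoffel G c x u v\<close> is the vector with components \<open>\<Gamma>\<^sup>k\<^sub>i\<^sub>j u\<^sup>i v\<^sup>j\<close>, and
  \<open>christoffel1\<close> is the same with the upper index lowered.
\<close>

definition christoffel1 ::
    "('m, 'n::finite) riem \<Rightarrow> ('m, 'n) chart \<Rightarrow> real^'n \<Rightarrow> real^'n \<Rightarrow> real^'n \<Rightarrow> real^'n" where
  "christoffel1 G c x u v = (\<chi> m.
     (frechet_derivative (\<lambda>y. metric_form G c y v (axis m 1)) (at x) u
      + frechet_derivative (\<lambda>y. metric_form G c y u (axis m 1)) (at x) v
      - frechet_derivative (\<lambda>y. metric_form G c y u v) (at x) (axis m 1)) / 2)"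

definition christoffel ::
    "('m, 'n::finite) riem \<Rightarrow> ('m, 'n) chart \<Rightarrow> real^'n \<Rightarrow> real^'n \<Rightarrow> real^'n \<Rightarrow> real^'n" where
  "christoffel G c x u v = matrix_inv (metric G c x) *v christoffel1 G c x u v"

text \<open>
  \<open>curv_coord G c x u v w\<close> is \<open>R(u,v)w\<close> in the chart \<open>c\<close>, with the convention
  \<open>R(X,Y)Z = \<nabla>\<^sub>X\<nabla>\<^sub>YZ - \<nabla>\<^sub>Y\<nabla>\<^sub>XZ - \<nabla>\<^bsub>[X,Y]\<^esub>Z\<close>,
  evaluated on fields with constant components. The Ricci tensor \<open>Ric(v,w)\<close> is the trace of
  \<open>u \<mapsto> R(u,v)w\<close>, and unit spheres have positive curvature.
\<close>

definition curv_coord ::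
    "('m, 'n::finite) riem \<Rightarrow> ('m, 'n) chart \<Rightarrow> real^'n \<Rightarrow> real^'n \<Rightarrow> real^'n \<Rightarrow> real^'n \<Rightarrow> real^'n" where
  "curv_coord G c x u v w =
     frechet_derivative (\<lambda>y. christoffel G c y v w) (at x) u
     - frechet_derivative (\<lambda>y. christoffel G c y u w) (at x) v
     + christoffel G c x u (christoffel G c x v w)
     - christoffel G c x v (christoffel G c x u w)"

definition curv ::
    "('m, 'n::finite) riem \<Rightarrow> 'm \<Rightarrow> ('m, 'n) tvec \<Rightarrow> ('m, 'n) tvec \<Rightarrow> ('m, 'n) tvec \<Rightarrow> ('m, 'n) tvec" where
  "curv G p u v w = (\<lambda>c. if c \<in> charts_at G p
     then curv_coord G c (coord c p) (u c) (v c) (w c) else 0)"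

definition Ric :: "('m, 'n::finite) riem \<Rightarrow> 'm \<Rightarrow> ('m, 'n) tvec \<Rightarrow> ('m, 'n) tvec \<Rightarrow> real" where
  "Ric G p v w = (let c = chart_at G p in
     trace (matrix (\<lambda>u. curv_coord G c (coord c p) u (v c) (w c))))"

definition sect_curv :: "('m, 'n::finite) riem \<Rightarrow> 'm \<Rightarrow> ('m, 'n) tvec \<Rightarrow> ('m, 'n) tvec \<Rightarrow> real" where
  "sect_curv G p u v = ip G p (curv G p u v v) u / (ip G p u u * ip G p v v - (ip G p u v)\<^sup>2)"

definition Ric_ge :: "('m, 'n::finite) riem \<Rightarrow> real \<Rightarrow> bool" where
  "Ric_ge G a \<longleftrightarrow> (\<forall>p. \<forall>v\<in>tangent_space G p. tnorm G p v = 1 \<longrightarrow> Ric G p v v \<ge> a)"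

text \<open>The side condition says that \<open>u\<close> and \<open>v\<close> span a plane.\<close>

definition constant_curvature :: "('m, 'n::finite) riem \<Rightarrow> real \<Rightarrow> bool" where
  "constant_curvature G k \<longleftrightarrow>
     (\<forall>p. \<forall>u\<in>tangent_space G p. \<forall>v\<in>tangent_space G p.
        ip G p u u * ip G p v v - (ip G p u v)\<^sup>2 \<noteq> 0 \<longrightarrow> sect_curv G p u v = k)"


section \<open>Curves and fields along them\<close>

text \<open>
  Curves are parametrized by a nondegenerate interval \<open>I\<close>; all derivatives are taken within \<open>I\<close>,
  hence are one-sided at its end points.
\<close>

definition differentiable_curve :: "('m::topological_space, 'n::finite) riem \<Rightarrow> real set \<Rightarrow> (real \<Rightarrow> 'm) \<Rightarrow> bool" where
  "differentiable_curve G I \<gamma> \<longleftrightarrow> continuous_on I \<gamma> \<and>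
     (\<forall>t\<in>I. \<forall>c\<in>charts_at G (\<gamma> t). (\<lambda>s. coord c (\<gamma> s)) differentiable (at t within I))"

definition velocity :: "('m, 'n::finite) riem \<Rightarrow> real set \<Rightarrow> (real \<Rightarrow> 'm) \<Rightarrow> real \<Rightarrow> ('m, 'n) tvec" where
  "velocity G I \<gamma> t = (\<lambda>c. if c \<in> charts_at G (\<gamma> t)
     then vector_derivative (\<lambda>s. coord c (\<gamma> s)) (at t within I) else 0)"

definition differentiable_field ::
    "('m, 'n::finite) riem \<Rightarrow> real set \<Rightarrow> (real \<Rightarrow> 'm) \<Rightarrow> (real \<Rightarrow> ('m, 'n) tvec) \<Rightarrow> bool" where
  "differentiable_field G I \<gamma> V \<longleftrightarrow>
     (\<forall>t\<in>I. V t \<in> tangent_space G (\<gamma> t) \<and>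
        (\<forall>c\<in>charts_at G (\<gamma> t). (\<lambda>s. V s c) differentiable (at t within I)))"

definition cov_deriv ::
    "('m, 'n::finite) riem \<Rightarrow> real set \<Rightarrow> (real \<Rightarrow> 'm) \<Rightarrow> (real \<Rightarrow> ('m, 'n) tvec) \<Rightarrow> real \<Rightarrow> ('m, 'n) tvec" where
  "cov_deriv G I \<gamma> V t = (\<lambda>c. if c \<in> charts_at G (\<gamma> t)
     then vector_derivative (\<lambda>s. V s c) (at t within I)
          + christoffel G c (coord c (\<gamma> t)) (velocity G I \<gamma> t c) (V t c)
     else 0)"

definition parallel_field ::
    "('m, 'n::finite) riem \<Rightarrow> real set \<Rightarrow> (real \<Rightarrow> 'm) \<Rightarrow> (real \<Rightarrow> ('m, 'n) tvec) \<Rightarrow> bool" where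
  "parallel_field G I \<gamma> V \<longleftrightarrow>
     differentiable_field G I \<gamma> V \<and> (\<forall>t\<in>I. cov_deriv G I \<gamma> V t = tzero)"

text \<open>
  Geodesics and Jacobi fields are required to be twice differentiable; their equations then make
  them smooth.
\<close>

definition geodesic :: "('m::topological_space, 'n::finite) riem \<Rightarrow> real set \<Rightarrow> (real \<Rightarrow> 'm) \<Rightarrow> bool" where
  "geodesic G I \<gamma> \<longleftrightarrow> differentiable_curve G I \<gamma> \<and> parallel_field G I \<gamma> (velocity G I \<gamma>)"

definition normal_geodesic :: "('m::topological_space, 'n::finite) riem \<Rightarrow> real set \<Rightarrow> (real \<Rightarrow> 'm) \<Rightarrow> bool" where
  "normal_geodesic G I \<gamma> \<longleftrightarrow>
     geodesic G I \<gamma> \<and> (\<forall>t\<in>I. tnorm G (\<gamma> t) (velocity G I \<gamma> t) = 1)"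

definition jacobi_field ::
    "('m, 'n::finite) riem \<Rightarrow> real set \<Rightarrow> (real \<Rightarrow> 'm) \<Rightarrow> (real \<Rightarrow> ('m, 'n) tvec) \<Rightarrow> bool" where
  "jacobi_field G I \<gamma> J \<longleftrightarrow>
     differentiable_field G I \<gamma> J \<and>
     differentiable_field G I \<gamma> (cov_deriv G I \<gamma> J) \<and>
     (\<forall>t\<in>I. tadd (cov_deriv G I \<gamma> (cov_deriv G I \<gamma> J) t)
                  (curv G (\<gamma> t) (J t) (velocity G I \<gamma> t) (velocity G I \<gamma> t)) = tzero)"

text \<open>
  \<open>B\<close> is meant to be a symmetric linear endomorphism of the tangent space at \<open>\<gamma> 0\<close>.
\<close>

definition focal_point ::
    "('m, 'n::finite) riem \<Rightarrow> (real \<Rightarrow> 'm) \<Rightarrow> (('m, 'n) tvec \<Rightarrow> ('m, 'n) tvec) \<Rightarrow> real \<Rightarrow> bool" where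
  "focal_point G \<gamma> B t \<longleftrightarrow>
     (\<exists>J. jacobi_field G {0..t} \<gamma> J \<and> J t = tzero \<and> J 0 \<noteq> tzero \<and>
          cov_deriv G {0..t} \<gamma> J 0 = B (J 0))"


section \<open>Space forms\<close>

definition geodesically_complete :: "('m::topological_space, 'n::finite) riem \<Rightarrow> bool" where
  "geodesically_complete G \<longleftrightarrow>
     (\<forall>p. \<forall>v\<in>tangent_space G p. \<exists>\<gamma>. geodesic G UNIV \<gamma> \<and> \<gamma> 0 = p \<and> velocity G UNIV \<gamma> 0 = v)"

text \<open>
  \<open>simply_connected\<close> includes path-connectedness. For \<open>CARD('n) \<ge> 2\<close> the conditions determine
  the manifold up to isometry.
\<close>

definition space_form ::
    "('m::{t2_space, second_countable_topology}, 'n::finite) riem \<Rightarrow> real \<Rightarrow> bool" where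
  "space_form G k \<longleftrightarrow>
     riemannian_manifold G \<and> simply_connected (UNIV :: 'm set) \<and>
     geodesically_complete G \<and> constant_curvature G k"

end

theory Submission
  imports Defs
begin

text \<open>
  Let \<open>T\<close> be the velocity of the geodesic, let a prime denote the covariant derivative along it, and
  put \<open>m = n - 1\<close>. The theorem is a comparison of Riccati equations.

  On \<open>M\<close>, the absence of focal points keeps the \<open>V\<^sub>i\<close> linearly independent (\<open>independent\<close>): a relation
  \<open>\<Sum> a\<^sub>i V\<^sub>i(t) = 0\<close> would make \<open>\<Sum> a\<^sub>i V\<^sub>i\<close> a Jacobi field that vanishes at \<open>t\<close>, is nonzero at \<open>0\<close> and satisfies the
  initial condition. So the \<open>V\<^sub>i\<close> and \<open>T\<close> form a frame, and \<open>V\<^sub>i' = \<Sum>\<^sub>j A\<^sub>i\<^sub>j V\<^sub>j\<close> for a matrix \<open>A\<close> (\<open>DV_eq\<close>), whose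
  product with the Gram matrix is symmetric because the Wronskians of the \<open>V\<^sub>i\<close> vanish (\<open>H_sym\<close>). The Jacobi
  equation becomes \<open>A' + A\<^sup>2 + R = 0\<close> (\<open>matrix_riccati\<close>), with trace \<open>tr A' + tr A\<^sup>2 = - Ric(T, T)\<close>
  (\<open>Ric_trace\<close>). Since \<open>tr A\<^sup>2 \<ge> (tr A)\<^sup>2 / m\<close> (\<open>trace_square_ge\<close>), the mean \<open>\<phi> = tr A / m\<close> satisfies
  \<open>\<phi>' \<le> - k - \<phi>\<^sup>2\<close>. By Liouville's formula \<open>\<phi>\<close> is the logarithmic derivative of \<open>w\<close>, the \<open>m\<close>-th root of the
  volume. Let \<open>f\<close> solve \<open>f'' + k f = 0\<close>, \<open>f(0) = 1\<close>, \<open>f'(0) = \<mu>\<close>. Sturm's argument shows that \<open>f\<close> stays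
  positive and that \<open>w / f\<close> is nonincreasing (\<open>f_pos\<close>, \<open>ratio_antimono\<close>), whence \<open>w \<le> w(0) f\<close>.

  In the space form the Jacobi operator is \<open>k\<close> times the identity on normal vectors, so the
  Gram matrix of the fields at \<open>t\<close> is the initial one times the square of the function \<open>f\<close> belonging to
  \<open>\<mu>S\<close> (\<open>Gr_constant_curvature\<close>). The two functions differ by \<open>(\<mu>S - \<mu>) sn k\<close>, where \<open>sn k\<close> solves the same
  equation with initial data \<open>(0, 1)\<close> and is positive on \<open>(0, l]\<close> because \<open>f\<close> is (\<open>sn_pos\<close>). This proves the
  inequality of volumes.

  If the volumes agree at \<open>t0\<close>, all inequalities used are equalities: \<open>\<mu> = \<mu>S\<close>, and \<open>w = w(0) f\<close> on
  \<open>[0, t0]\<close>, so that \<open>\<phi>' = - k - \<phi>\<^sup>2\<close> there (\<open>rigidity\<close>) and \<open>A = \<phi> I\<close> (\<open>umbilic_of_equality\<close>). The equation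
  \<open>V\<^sub>i' = \<phi> V\<^sub>i\<close> with \<open>\<phi> = f' / f\<close> contains the remaining claims.

  The geometric input consists of the product rule for scalar products along a curve (\<open>ip_deriv\<close>)
  and of the symmetries of the curvature tensor (\<open>jacobi_operator_sym\<close>, \<open>curv_metric_diagonal\<close>). They
  are derived from the coordinate formulas; the skew-symmetry in the last two arguments rests on the
  symmetry of second derivatives of the metric (\<open>mixed_partials_commute\<close>).
\<close>

section \<open>Matrices: differentiability, determinants and traces\<close>

lemma bounded_bilinear_matrix_vector_mult:
  "bounded_bilinear (\<lambda>(A :: real^'n^'m) x. A *v x)"
  unfolding bilinear_conv_bounded_bilinear [symmetric] bilinear_def
  by (auto intro!: linearI simp: matrix_vector_mult_add_rdistrib matrix_vector_right_distrib
      scaleR_matrix_vector_assoc matrix_vector_mult_scaleR)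

lemmas has_derivative_matrix_vector_mult =
  bounded_bilinear.FDERIV [OF bounded_bilinear_matrix_vector_mult]

lemma differentiable_vec_componentwise:
  fixes f :: "'a::real_normed_vector \<Rightarrow> 'b::euclidean_space^'m"
  assumes "\<And>i. (\<lambda>y. f y $ i) differentiable (at x within S)"
  shows "f differentiable (at x within S)"
proof -
  have "\<forall>i. \<exists>D. ((\<lambda>y. f y $ i) has_derivative D) (at x within S)"
    using assms unfolding differentiable_def by simp
  from choice [OF this] obtain D
    where D: "\<And>i. ((\<lambda>y. f y $ i) has_derivative D i) (at x within S)" by auto
  have "(f has_derivative (\<lambda>h. \<chi> i. D i h)) (at x within S)"
    unfolding has_derivative_componentwise_within [of f]
    by (auto simp: Basis_vec_def inner_axis intro: has_derivative_inner_left D)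
  then show ?thesis by (auto simp: differentiable_def)
qed

lemma differentiable_det:
  fixes A :: "'a::real_normed_vector \<Rightarrow> real^'n^'n"
  assumes "\<And>i j. (\<lambda>y. A y $ i $ j) differentiable (at x within S)"
  shows "(\<lambda>y. det (A y)) differentiable (at x within S)"
proof -
  have *: "(\<lambda>y. \<Prod>i\<in>UNIV. A y $ i $ p i) differentiable (at x within S)" for p
  proof -
    have "\<forall>i. \<exists>D. ((\<lambda>y. A y $ i $ p i) has_derivative D) (at x within S)"
      using assms unfolding differentiable_def by simp
    from choice [OF this] obtain D
      where "\<And>i. ((\<lambda>y. A y $ i $ p i) has_derivative D i) (at x within S)" by auto
    then show ?thesis by (rule differentiableI [OF has_derivative_prod])
  qed
  show ?thesis
    unfolding det_def
    by (rule differentiable_sum [OF finite_permutations [OF finite]], rule ballI,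
        rule differentiable_mult [OF differentiable_const *])
qed

lemma matrix_inv_inverse:
  fixes A :: "real^'n^'n"
  assumes "invertible A"
  shows "A ** matrix_inv A = mat 1" "matrix_inv A ** A = mat 1"
  using someI_ex [OF assms [unfolded invertible_def]] unfolding matrix_inv_def by auto

lemma matrix_inv_mult_vec:
  fixes A :: "real^'n^'n"
  assumes "invertible A"
  shows "A *v (matrix_inv A *v b) = b"
  using matrix_inv_inverse [OF assms] by (simp add: matrix_vector_mul_assoc)

text \<open>
  By Cramer's rule each component of the solution of a linear system is a quotient of two
  determinants in the data. This yields both the differentiability of the Christoffel symbols and
  that of the matrix which expresses the derivatives of a Jacobi frame in the frame itself.
\<close>

lemma differentiable_matrix_inv_mult_vec:
  fixes A :: "'a::real_normed_vector \<Rightarrow> real^'n^'n"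
  assumes A: "A differentiable (at x within S)" and b: "b differentiable (at x within S)"
    and inv: "\<And>y. y \<in> S \<Longrightarrow> invertible (A y)" and x: "x \<in> S"
  shows "(\<lambda>y. matrix_inv (A y) *v b y) differentiable (at x within S)"
proof (rule differentiable_vec_componentwise)
  fix k
  have nth: "(\<lambda>y. f y $ i) differentiable (at x within S)"
    if "f differentiable (at x within S)" for f :: "'a \<Rightarrow> 'b::real_normed_vector^'m" and i
    using that bounded_linear.has_derivative [OF bounded_linear_vec_nth]
    unfolding differentiable_def by blast
  let ?M = "\<lambda>y. \<chi> i j. if j = k then b y $ i else A y $ i $ j"
  have d: "det (A y) \<noteq> 0" if "y \<in> S" for y
    using inv [OF that] by (simp add: invertible_det_nz)
  have eq: "(matrix_inv (A y) *v b y) $ k = det (?M y) / det (A y)" if "y \<in> S" for y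
    using cramer [OF d [OF that], of "matrix_inv (A y) *v b y" "b y"]
      matrix_inv_mult_vec [OF inv [OF that]] by (metis (no_types, lifting) vec_lambda_beta)
  have "(\<lambda>y. det (?M y) / det (A y)) differentiable (at x within S)"
  proof (intro differentiable_divide differentiable_det)
    fix i j
    show "(\<lambda>y. A y $ i $ j) differentiable (at x within S)"
      by (intro nth A)
    show "(\<lambda>y. (?M y) $ i $ j) differentiable (at x within S)"
      by (cases "j = k") (auto intro!: nth A b)
  qed (use d x in auto)
  then show "(\<lambda>y. (matrix_inv (A y) *v b y) $ k) differentiable (at x within S)"
    unfolding differentiable_def
    by (elim ex_forward has_derivative_transform [rotated -1]) (use eq x in auto)
qed

text \<open>
  Only the \<open>i\<close>-th summand of the new row survives, all others repeat a row that is already there.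
\<close>

lemma det_replace_row_by_combination:
  fixes A B :: "real^'n^'n"
  shows "det (\<chi> r. if r = i then (B ** A) $ i else A $ r) = B $ i $ i * det A"
proof -
  have row: "(B ** A) $ i = (\<Sum>k\<in>UNIV. B $ i $ k *s A $ k)"
    by (simp add: vec_eq_iff matrix_matrix_mult_def)
  have "det (\<chi> r. if r = i then (B ** A) $ i else A $ r)
      = (\<Sum>k\<in>UNIV. det (\<chi> r. if r = i then B $ i $ k *s A $ k else A $ r))"
    unfolding row using det_linear_row_sum [of UNIV i "\<lambda>_ k. B $ i $ k *s A $ k" "\<lambda>r. A $ r"] by simp
  also have "\<dots> = (\<Sum>k\<in>UNIV. B $ i $ k * det (\<chi> r. if r = i then A $ k else A $ r))"
    by (intro sum.cong refl) (use det_row_mul [of i _ "\<lambda>_. A $ _" "\<lambda>r. A $ r"] in auto)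
  also have "\<dots> = (\<Sum>k\<in>UNIV. if k = i then B $ i $ i * det A else 0)"
  proof (intro sum.cong refl)
    fix k
    have "det (\<chi> r. if r = i then A $ k else A $ r) = 0" if "k \<noteq> i"
      by (rule det_identical_rows [of i k]) (use that in \<open>auto simp: row_def vec_eq_iff\<close>)
    moreover have "(\<chi> r. if r = i then A $ i else A $ r) = A" by (simp add: vec_eq_iff)
    ultimately show "B $ i $ k * det (\<chi> r. if r = i then A $ k else A $ r)
        = (if k = i then B $ i $ i * det A else 0)" by auto
  qed
  finally show ?thesis by simp
qed

text \<open>
  Liouville's formula: if \<open>G' = B G\<close> at \<open>t\<close>, then \<open>(det G)' = tr B \<cdot> det G\<close>. The product rule
  replaces the rows of \<open>G\<close> one after the other by those of \<open>B G\<close>.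
\<close>

lemma det_has_derivative_Liouville:
  fixes G :: "real \<Rightarrow> real^'n^'n"
  assumes G: "\<And>i j. ((\<lambda>s. G s $ i $ j) has_real_derivative (B ** G t) $ i $ j) (at t within I)"
  shows "((\<lambda>s. det (G s)) has_real_derivative trace B * det (G t)) (at t within I)"
proof -
  let ?P = "{p. p permutes (UNIV :: 'n set)}"
  have pr: "((\<lambda>s. \<Prod>i\<in>UNIV. G s $ i $ p i) has_real_derivative
      (\<Sum>i\<in>UNIV. (B ** G t) $ i $ p i * (\<Prod>j\<in>UNIV - {i}. G t $ j $ p j))) (at t within I)" for p
  proof -
    have "((\<lambda>s. \<Prod>i\<in>UNIV. G s $ i $ p i) has_derivative
        (\<lambda>y. \<Sum>i\<in>UNIV. (*) ((B ** G t) $ i $ p i) y * (\<Prod>j\<in>UNIV - {i}. G t $ j $ p j)))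
        (at t within I)"
      using G unfolding has_field_derivative_def by (intro has_derivative_prod)
    then show ?thesis
      unfolding has_field_derivative_def
      by (rule has_derivative_eq_rhs) (auto simp: fun_eq_iff sum_distrib_left mult_ac)
  qed
  have "((\<lambda>s. det (G s)) has_real_derivative (\<Sum>p\<in>?P. of_int (sign p) *
      (\<Sum>i\<in>UNIV. (B ** G t) $ i $ p i * (\<Prod>j\<in>UNIV - {i}. G t $ j $ p j)))) (at t within I)"
    unfolding det_def by (intro DERIV_sum DERIV_cmult pr)
  also have "(\<Sum>p\<in>?P. of_int (sign p) *
      (\<Sum>i\<in>UNIV. (B ** G t) $ i $ p i * (\<Prod>j\<in>UNIV - {i}. G t $ j $ p j)))
    = (\<Sum>i\<in>UNIV. \<Sum>p\<in>?P. of_int (sign p) *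
       (\<Prod>j\<in>UNIV. (\<chi> r. if r = i then (B ** G t) $ i else G t $ r) $ j $ p j))"
    unfolding sum_distrib_left
  proof (subst sum.swap, intro sum.cong refl, goal_cases)
    case (1 i p)
    have "(\<Prod>j\<in>UNIV. (\<chi> r. if r = i then (B ** G t) $ i else G t $ r) $ j $ p j)
      = (B ** G t) $ i $ p i *
        (\<Prod>j\<in>UNIV - {i}. (\<chi> r. if r = i then (B ** G t) $ i else G t $ r) $ j $ p j)"
      by (subst prod.remove [of _ i]) auto
    also have "(\<Prod>j\<in>UNIV - {i}. (\<chi> r. if r = i then (B ** G t) $ i else G t $ r) $ j $ p j)
      = (\<Prod>j\<in>UNIV - {i}. G t $ j $ p j)"
      by (intro prod.cong) auto
    finally show ?case by simp
  qed
  also have "\<dots> = (\<Sum>i\<in>UNIV. B $ i $ i * det (G t))"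
    unfolding det_replace_row_by_combination [symmetric] by (simp add: det_def)
  also have "\<dots> = trace B * det (G t)"
    by (simp add: trace_def sum_distrib_right)
  finally show ?thesis .
qed

text \<open>
  The rows of the inverse of \<open>Q\<close> form an orthonormal basis for the scalar product \<open>G\<close>. Such a basis is an orthonormal
  set of maximal cardinality: a vector outside its span could be made orthogonal to it,
  normalized and added.
\<close>

lemma positive_definite_factorization:
  fixes G :: "real^'n^'n"
  assumes sym: "transpose G = G" and pos: "\<And>c. c \<noteq> 0 \<Longrightarrow> c \<bullet> (G *v c) > 0"
  obtains Q :: "real^'n^'n" where "invertible Q" "G = Q ** transpose Q"
proof -
  define g where "g u v = u \<bullet> (G *v v)" for u v
  have g_sym: "g u v = g v u" for u v
    unfolding g_def using sym by (metis dot_lmul_matrix inner_commute transpose_matrix_vector)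
  have g_lin: "linear (g u)" for u
    unfolding g_def by (auto intro!: linearI simp: matrix_vector_right_distrib inner_right_distrib
        matrix_vector_mult_scaleR)
  define ON where "ON B \<longleftrightarrow> finite B \<and> (\<forall>u\<in>B. \<forall>v\<in>B. g u v = (if u = v then 1 else 0))" for B
  have coeff: "g v (\<Sum>u\<in>B. a u *\<^sub>R u) = a v" if "ON B" "v \<in> B" for B a v
  proof -
    have "g v (\<Sum>u\<in>B. a u *\<^sub>R u) = (\<Sum>u\<in>B. a u * g v u)"
      by (simp add: linear_sum [OF g_lin] linear_scale [OF g_lin])
    also have "\<dots> = (\<Sum>u\<in>B. if u = v then a v else 0)"
      using that by (intro sum.cong) (auto simp: ON_def)
    finally show ?thesis using that by (auto simp: ON_def)
  qed
  have indep: "independent B" if "ON B" for B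
  proof (subst independent_explicit_module, safe)
    fix t u v assume t: "finite t" "t \<subseteq> B" "(\<Sum>v\<in>t. u v *\<^sub>R v) = 0" "v \<in> t"
    have "ON t" using that t unfolding ON_def by (metis subset_iff)
    from coeff [OF this \<open>v \<in> t\<close>, of u] t(3) show "u v = 0"
      using linear_0 [OF g_lin] by simp
  qed
  have bound: "card B \<le> CARD('n)" if "ON B" for B
    using independent_bound [OF indep [OF that]] by simp
  have "ON {}" by (simp add: ON_def)
  then obtain B where B: "ON B" and max: "\<And>C. ON C \<Longrightarrow> card C \<le> card B"
    using ex_has_greatest_nat [of ON "{}" card "Suc CARD('n)"] bound by (auto simp: less_Suc_eq_le)
  have span: "span B = UNIV"
  proof (rule ccontr)
    assume "span B \<noteq> UNIV"
    then obtain x where x: "x \<notin> span B" by auto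
    define y where "y = x - (\<Sum>b\<in>B. g b x *\<^sub>R b)"
    have y0: "y \<noteq> 0"
    proof
      assume "y = 0"
      then have "x = (\<Sum>b\<in>B. g b x *\<^sub>R b)" by (simp add: y_def)
      moreover have "(\<Sum>b\<in>B. g b x *\<^sub>R b) \<in> span B"
        by (intro span_sum span_scale span_base)
      ultimately show False using x by simp
    qed
    have yb: "g b y = 0" if "b \<in> B" for b
      unfolding y_def using coeff [OF B that] by (simp add: linear_diff [OF g_lin])
    have yy: "g y y > 0" using pos [OF y0] by (simp add: g_def)
    define z where "z = (1 / sqrt (g y y)) *\<^sub>R y"
    have zb: "g b z = 0" if "b \<in> B" for b
      using yb [OF that] by (simp add: z_def linear_scale [OF g_lin])
    have "g z z = (1 / sqrt (g y y)) * (1 / sqrt (g y y)) * g y y"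
      using g_sym [of z y] by (simp add: z_def linear_scale [OF g_lin])
    also have "\<dots> = 1" using yy by (simp add: power_divide flip: power2_eq_square)
    finally have zz: "g z z = 1" .
    have "z \<notin> B" using zb zz by force
    moreover have "ON (insert z B)"
      using B zb zz g_sym by (auto simp: ON_def)
    ultimately show False using max [of "insert z B"] B by (auto simp: ON_def)
  qed
  have "card B = CARD('n)"
    using dim_eq_card_independent [OF indep [OF B]] span by (metis dim_UNIV dim_span DIM_cart DIM_real nat_mult_1_right)
  then obtain h :: "'n \<Rightarrow> real^'n" where h: "bij_betw h UNIV B"
    using B finite_same_card_bij [of "UNIV :: 'n set" B] by (auto simp: ON_def)
  define R :: "real^'n^'n" where "R = (\<chi> i. h i)"
  have "(R ** G ** transpose R) $ i $ j = g (h i) (h j)" for i j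
    unfolding R_def g_def matrix_matrix_mult_def transpose_def matrix_vector_mult_def inner_vec_def
    by (simp add: sum_distrib_left sum_distrib_right) (subst sum.swap, simp add: mult.assoc)
  moreover have "g (h i) (h j) = (if i = j then 1 else 0)" for i j
    using B h by (auto simp: ON_def bij_betw_def inj_on_def)
  ultimately have RGR: "R ** G ** transpose R = mat 1"
    by (simp add: vec_eq_iff mat_def)
  then have "invertible R"
    by (metis invertible_right_inverse matrix_mul_assoc)
  then obtain Q where Q: "Q ** R = mat 1" "R ** Q = mat 1" by (auto simp: invertible_def)
  have "transpose R ** transpose Q = mat 1"
    using Q(1) by (metis matrix_transpose_mul transpose_mat)
  then have "G = (Q ** R) ** G ** (transpose R ** transpose Q)"
    using Q by simp
  also have "\<dots> = Q ** (R ** G ** transpose R) ** transpose Q"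
    by (simp add: matrix_mul_assoc)
  finally have "G = Q ** transpose Q" using RGR by simp
  moreover have "invertible Q" using Q by (auto simp: invertible_def)
  ultimately show thesis using that by blast
qed

text \<open>
  The transpose of \<open>B\<close> is self-adjoint for the scalar product \<open>G\<close>, hence similar to a symmetric
  matrix; so \<open>B\<close> is similar to a symmetric matrix \<open>C\<close>, and
  \<open>tr C\<^sup>2\<close> is the sum of the squares of the entries of \<open>C\<close>.
\<close>

lemma trace_square_selfadjoint:
  fixes B G :: "real^'n^'n"
  assumes sym: "transpose G = G" and pos: "\<And>c. c \<noteq> 0 \<Longrightarrow> c \<bullet> (G *v c) > 0"
    and BG: "transpose (B ** G) = B ** G"
  shows "0 \<le> trace (B ** B)" "trace (B ** B) = 0 \<Longrightarrow> B = 0"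
proof -
  obtain Q :: "real^'n^'n" where Q: "invertible Q" "G = Q ** transpose Q"
    using positive_definite_factorization [OF sym pos] by blast
  then obtain P where P: "P ** Q = mat 1" "Q ** P = mat 1" by (auto simp: invertible_def)
  have Pt: "transpose Q ** transpose P = mat 1"
    using P(1) by (metis matrix_transpose_mul transpose_mat)
  define C where "C = P ** B ** Q"
  have C: "C = P ** (B ** G) ** transpose P"
    unfolding C_def Q(2) using Pt by (metis matrix_mul_assoc matrix_mul_rid)
  have Csym: "transpose C = C"
    unfolding C using BG by (metis matrix_mul_assoc matrix_transpose_mul transpose_transpose)
  have BC: "B = Q ** C ** P"
    unfolding C_def using P by (metis matrix_mul_assoc matrix_mul_lid matrix_mul_rid)
  have "trace (B ** B) = trace (Q ** (C ** C ** P))"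
    unfolding BC using P by (metis matrix_mul_assoc matrix_mul_rid)
  also have "\<dots> = trace (C ** C)"
    using P by (metis trace_mul_sym matrix_mul_assoc matrix_mul_rid)
  also have "\<dots> = (\<Sum>i\<in>UNIV. \<Sum>j\<in>UNIV. C $ i $ j * C $ i $ j)"
    unfolding trace_def matrix_matrix_mult_def
    using Csym by (auto simp: transpose_def vec_eq_iff intro!: sum.cong)
  finally have tr: "trace (B ** B) = (\<Sum>i\<in>UNIV. \<Sum>j\<in>UNIV. C $ i $ j * C $ i $ j)" .
  then show "0 \<le> trace (B ** B)" by (auto intro!: sum_nonneg)
  assume "trace (B ** B) = 0"
  then have "C = 0"
    unfolding tr by (simp add: sum_nonneg_eq_0_iff sum_nonneg vec_eq_iff)
  then show "B = 0" unfolding BC by (simp add: matrix_matrix_mult_def zero_vec_def)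
qed

text \<open>
  The Cauchy--Schwarz inequality for the eigenvalues of a self-adjoint matrix, obtained without
  diagonalization from the trace-free part \<open>A - \<phi> I\<close>. The equality case is what makes the Jacobi
  frame umbilic when volumes agree.
\<close>

lemma trace_square_ge:
  fixes A G :: "real^'n^'n"
  assumes sym: "transpose G = G" and pos: "\<And>c. c \<noteq> 0 \<Longrightarrow> c \<bullet> (G *v c) > 0"
    and AG: "transpose (A ** G) = A ** G"
  defines "\<phi> \<equiv> trace A / real CARD('n)"
  shows "real CARD('n) * \<phi>\<^sup>2 \<le> trace (A ** A)"
    "trace (A ** A) = real CARD('n) * \<phi>\<^sup>2 \<Longrightarrow> A = mat \<phi>"
proof -
  define B where "B = A - mat \<phi>"
  have m: "mat \<phi> ** X = \<phi> *\<^sub>R X" "X ** mat \<phi> = \<phi> *\<^sub>R X" for X :: "real^'n^'n"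
    by (auto simp: mat_def matrix_matrix_mult_def vec_eq_iff if_distrib [of "\<lambda>x. x * _"]
        if_distrib [of "\<lambda>x. _ * x"] cong: if_cong)
  have sub: "(X - Y) ** Z = X ** Z - Y ** Z" "Z ** (X - Y) = Z ** X - Z ** Y" for X Y Z :: "real^'n^'n"
    by (auto simp: matrix_matrix_mult_def vec_eq_iff algebra_simps sum_subtractf)
  have ts: "trace (r *\<^sub>R X) = r * trace X" for r and X :: "real^'n^'n"
    by (simp add: trace_def sum_distrib_left)
  have tm: "trace (mat \<phi> :: real^'n^'n) = real CARD('n) * \<phi>"
    by (simp add: trace_def mat_def)
  have "trace A = real CARD('n) * \<phi>" by (simp add: \<phi>_def)
  then have tr: "trace (B ** B) = trace (A ** A) - real CARD('n) * \<phi>\<^sup>2"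
    unfolding B_def sub m trace_sub ts tm by (simp add: algebra_simps power2_eq_square)
  have "transpose (B ** G) = B ** G"
    using AG sym unfolding B_def sub m by (simp add: transpose_def vec_eq_iff)
  \<comment> \<open>The trace of \<open>B\<^sup>2\<close> is the defect in the claimed inequality.\<close>
  note * = trace_square_selfadjoint [OF sym pos this]
  show "real CARD('n) * \<phi>\<^sup>2 \<le> trace (A ** A)" using *(1) tr by simp
  show "A = mat \<phi>" if "trace (A ** A) = real CARD('n) * \<phi>\<^sup>2"
    using *(2) tr that by (simp add: B_def)
qed

text \<open>
  The basis is indexed by a type other than that of the coordinates because it will consist of a
  family of normal vectors together with the velocity.
\<close>

lemma trace_matrix_in_basis:
  fixes L :: "real^'n \<Rightarrow> real^'n" and b :: "'j::finite \<Rightarrow> real^'n"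
  assumes L: "linear L" and card: "CARD('j) = CARD('n)"
    and indep: "\<And>a. (\<Sum>j\<in>UNIV. a j *\<^sub>R b j) = 0 \<Longrightarrow> a = (\<lambda>_. 0)"
    and N: "\<And>i. L (b i) = (\<Sum>j\<in>UNIV. N i j *\<^sub>R b j)"
  shows "trace (matrix L) = (\<Sum>i\<in>UNIV. N i i)"
proof -
  obtain h :: "'n \<Rightarrow> 'j" where h: "bij h"
    using finite_same_card_bij [of "UNIV :: 'n set" "UNIV :: 'j set"] card by auto
  define P :: "real^'n^'n" where "P = (\<chi> a r. b (h r) $ a)"
  define N' :: "real^'n^'n" where "N' = (\<chi> s r. N (h r) (h s))"
  have "c = 0" if "P *v c = 0" for c
  proof -
    have "(\<Sum>j\<in>UNIV. c $ inv h j *\<^sub>R b j) = (\<Sum>r\<in>UNIV. c $ r *\<^sub>R b (h r))"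
      using sum.reindex_bij_betw [OF h, of "\<lambda>j. c $ inv h j *\<^sub>R b j"] h
      by (simp add: bij_is_inj)
    also have "\<dots> = P *v c"
      by (simp add: P_def matrix_vector_mult_def vec_eq_iff mult.commute)
    finally have "(\<lambda>j. c $ inv h j) = (\<lambda>_. 0)" using indep that by auto
    then have "c $ r = 0" for r using h by (metis bij_is_inj inv_f_f)
    then show ?thesis by (simp add: vec_eq_iff)
  qed
  then have "\<exists>P'. P' ** P = mat 1" by (simp add: matrix_left_invertible_ker)
  then obtain P' where P': "P' ** P = mat 1" "P ** P' = mat 1"
    using matrix_left_right_inverse by blast
  have LP: "matrix L ** P = P ** N'"
  proof (clarsimp simp: vec_eq_iff)
    fix a r
    have "(matrix L ** P) $ a $ r = (matrix L *v b (h r)) $ a"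
      by (simp add: matrix_matrix_mult_def matrix_vector_mult_def P_def)
    also have "\<dots> = L (b (h r)) $ a" using L by (simp add: matrix_works)
    also have "\<dots> = (\<Sum>j\<in>UNIV. N (h r) j * b j $ a)" by (simp add: N)
    also have "\<dots> = (\<Sum>s\<in>UNIV. N (h r) (h s) * b (h s) $ a)"
      using sum.reindex_bij_betw [OF h, of "\<lambda>j. N (h r) j * b j $ a"] by simp
    also have "\<dots> = (P ** N') $ a $ r"
      by (simp add: matrix_matrix_mult_def P_def N'_def mult.commute)
    finally show "(matrix L ** P) $ a $ r = (P ** N') $ a $ r" .
  qed
  have "trace (matrix L) = trace (P ** (N' ** P'))"
    using LP P' by (metis matrix_mul_assoc matrix_mul_rid)
  also have "\<dots> = trace N'"
    using P' by (metis trace_mul_sym matrix_mul_assoc matrix_mul_rid)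
  also have "\<dots> = (\<Sum>i\<in>UNIV. N i i)"
    using sum.reindex_bij_betw [OF h, of "\<lambda>i. N i i"] by (simp add: trace_def N'_def)
  finally show ?thesis .
qed

lemma independent_family_spans:
  fixes b :: "'j::finite \<Rightarrow> real^'n"
  assumes card: "CARD('j) = CARD('n)"
    and indep: "\<And>a. (\<Sum>j\<in>UNIV. a j *\<^sub>R b j) = 0 \<Longrightarrow> a = (\<lambda>_. 0)"
  obtains a where "x = (\<Sum>j\<in>UNIV. a j *\<^sub>R b j)"
proof -
  define L :: "real^'j \<Rightarrow> real^'n" where "L c = (\<Sum>j\<in>UNIV. c $ j *\<^sub>R b j)" for c
  have L: "linear L"
    unfolding L_def by (intro linearI) (simp_all add: scaleR_add_left sum.distrib scaleR_sum_right)
  have "c = 0" if "L c = 0" for c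
    using indep [of "\<lambda>j. c $ j"] that by (simp add: L_def vec_eq_iff fun_eq_iff)
  then have "inj L" using linear_injective_0 [OF L] by blast
  then have "dim (range L) = CARD('n)"
    using dim_image_eq [OF L, of UNIV] card by (simp add: inj_on_def)
  then have "span (range L) = UNIV" using dim_eq_full [of "range L"] by simp
  moreover have "span (range L) = range L"
    using L by (simp add: linear_subspace_image)
  ultimately obtain c where "x = L c" by (metis UNIV_I imageE)
  then show thesis using that [of "\<lambda>j. c $ j"] by (simp add: L_def)
qed

section \<open>Symmetry of second derivatives\<close>

text \<open>
  The second difference of \<open>F\<close> over a parallelogram is a second derivative at some point of it, by
  two applications of the mean value theorem. The left-hand side is symmetric in \<open>u\<close> and \<open>v\<close>, the
  order of differentiation on the right-hand side is not.
\<close>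

lemma second_difference_mean_value:
  fixes F :: "'a::real_normed_vector \<Rightarrow> real"
  assumes F: "\<And>y. y \<in> X \<Longrightarrow> (F has_derivative F' y) (at y)"
    and Fu: "\<And>y. y \<in> X \<Longrightarrow> ((\<lambda>z. F' z u) has_derivative Fu y) (at y)"
    and s: "0 \<le> s"
    and X: "\<And>a b. 0 \<le> a \<Longrightarrow> a \<le> s \<Longrightarrow> 0 \<le> b \<Longrightarrow> b \<le> s \<Longrightarrow> x + a *\<^sub>R u + b *\<^sub>R v \<in> X"
  obtains a b where "0 \<le> a" "a \<le> s" "0 \<le> b" "b \<le> s"
    "F (x + s *\<^sub>R u + s *\<^sub>R v) - F (x + s *\<^sub>R u) - F (x + s *\<^sub>R v) + F x
      = s * s * Fu (x + a *\<^sub>R u + b *\<^sub>R v) v"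
proof -
  have lin: "F' y (h *\<^sub>R u) = h * F' y u" "Fu y (h *\<^sub>R v) = h * Fu y v" if "y \<in> X" for y h
    using linear_scale [OF has_derivative_linear [OF F [OF that]]]
      linear_scale [OF has_derivative_linear [OF Fu [OF that]]] by simp_all
  have F_line: "((\<lambda>a. F (x + a *\<^sub>R u + b *\<^sub>R v)) has_derivative
      (\<lambda>h. h * F' (x + a *\<^sub>R u + b *\<^sub>R v) u)) (at a within S)"
    if "0 \<le> a" "a \<le> s" "0 \<le> b" "b \<le> s" for a b S
  proof -
    have "((\<lambda>a. x + a *\<^sub>R u + b *\<^sub>R v) has_derivative (\<lambda>h. h *\<^sub>R u)) (at a within S)"
      by (auto intro!: derivative_eq_intros)
    from has_derivative_compose [OF this F [OF X [OF that]]] show ?thesis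
      using lin(1) [OF X [OF that]] by simp
  qed
  have "\<exists>a\<in>{0..s}. (F (x + s *\<^sub>R u + s *\<^sub>R v) - F (x + s *\<^sub>R u + 0 *\<^sub>R v))
      - (F (x + 0 *\<^sub>R u + s *\<^sub>R v) - F (x + 0 *\<^sub>R u + 0 *\<^sub>R v))
      = (s - 0) * F' (x + a *\<^sub>R u + s *\<^sub>R v) u - (s - 0) * F' (x + a *\<^sub>R u + 0 *\<^sub>R v) u"
    by (rule mvt_very_simple [OF s, where f = "\<lambda>a. F (x + a *\<^sub>R u + s *\<^sub>R v) - F (x + a *\<^sub>R u + 0 *\<^sub>R v)"])
      (intro has_derivative_diff F_line; use s in simp)
  then obtain a where a: "0 \<le> a" "a \<le> s"
    and eq: "F (x + s *\<^sub>R u + s *\<^sub>R v) - F (x + s *\<^sub>R u) - F (x + s *\<^sub>R v) + F x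
      = s * (F' (x + a *\<^sub>R u + s *\<^sub>R v) u - F' (x + a *\<^sub>R u + 0 *\<^sub>R v) u)"
    by (auto simp: algebra_simps)
  have F'_line: "((\<lambda>b. F' (x + a *\<^sub>R u + b *\<^sub>R v) u) has_derivative
      (\<lambda>h. h * Fu (x + a *\<^sub>R u + b *\<^sub>R v) v)) (at b within S)"
    if "0 \<le> b" "b \<le> s" for b S
  proof -
    have "((\<lambda>b. x + a *\<^sub>R u + b *\<^sub>R v) has_derivative (\<lambda>h. h *\<^sub>R v)) (at b within S)"
      by (auto intro!: derivative_eq_intros)
    from has_derivative_compose [OF this Fu [OF X [OF a that]]] show ?thesis
      using lin(2) [OF X [OF a that]] by simp
  qed
  have "\<exists>b\<in>{0..s}. F' (x + a *\<^sub>R u + s *\<^sub>R v) u - F' (x + a *\<^sub>R u + 0 *\<^sub>R v) u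
      = (s - 0) * Fu (x + a *\<^sub>R u + b *\<^sub>R v) v"
    by (rule mvt_very_simple [OF s, where f = "\<lambda>b. F' (x + a *\<^sub>R u + b *\<^sub>R v) u"]) (rule F'_line)
  then obtain b where "0 \<le> b" "b \<le> s"
    "F' (x + a *\<^sub>R u + s *\<^sub>R v) u - F' (x + a *\<^sub>R u + 0 *\<^sub>R v) u = s * Fu (x + a *\<^sub>R u + b *\<^sub>R v) v"
    by auto
  with a eq that show thesis by simp
qed

text \<open>
  Schwarz's theorem. If the two mixed derivatives at \<open>x\<close> differed, then by continuity they would
  differ at any two points of a small parallelogram, yet both represent its second difference.
\<close>

lemma mixed_partials_commute:
  fixes F :: "'a::real_normed_vector \<Rightarrow> real"
  assumes X: "open X" "x \<in> X"
    and F: "\<And>y. y \<in> X \<Longrightarrow> (F has_derivative F' y) (at y)"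
    and Fu: "\<And>y. y \<in> X \<Longrightarrow> ((\<lambda>z. F' z u) has_derivative Fu y) (at y)"
    and Fv: "\<And>y. y \<in> X \<Longrightarrow> ((\<lambda>z. F' z v) has_derivative Fv y) (at y)"
    and cont: "continuous (at x) (\<lambda>y. Fu y v)" "continuous (at x) (\<lambda>y. Fv y u)"
  shows "Fu x v = Fv x u"
proof (rule ccontr)
  assume ne: "Fu x v \<noteq> Fv x u"
  define e where "e = \<bar>Fu x v - Fv x u\<bar> / 2"
  have e: "e > 0" using ne by (simp add: e_def)
  have near: "\<exists>d>0. \<forall>y. dist y x < d \<longrightarrow> \<bar>f y - f x\<bar> < e" if "continuous (at x) f" for f :: "'a \<Rightarrow> real"
    using that e unfolding continuous_within_eps_delta by (auto simp: dist_real_def)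
  obtain d1 where d1: "d1 > 0" "\<And>y. dist y x < d1 \<Longrightarrow> \<bar>Fu y v - Fu x v\<bar> < e"
    using near [OF cont(1)] by auto
  obtain d2 where d2: "d2 > 0" "\<And>y. dist y x < d2 \<Longrightarrow> \<bar>Fv y u - Fv x u\<bar> < e"
    using near [OF cont(2)] by auto
  obtain d3 where d3: "d3 > 0" "\<And>y. dist y x < d3 \<Longrightarrow> y \<in> X"
    using X unfolding open_dist by auto
  define d where "d = min d1 (min d2 d3)"
  have d: "d > 0" using d1 d2 d3 by (simp add: d_def)
  \<comment> \<open>Small enough that the parallelogram spanned by \<open>s u\<close> and \<open>s v\<close> lies within distance \<open>d\<close> of \<open>x\<close>.\<close>
  define s where "s = d / (norm u + norm v + 1)"
  have s: "s > 0" using d by (simp add: s_def add_nonneg_pos)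
  have close: "dist (x + a *\<^sub>R p + b *\<^sub>R q) x < d"
    if "0 \<le> a" "a \<le> s" "0 \<le> b" "b \<le> s" "norm p + norm q = norm u + norm v" for a b p q
  proof -
    have "norm (a *\<^sub>R p + b *\<^sub>R q) \<le> a * norm p + b * norm q"
      using that norm_triangle_ineq [of "a *\<^sub>R p" "b *\<^sub>R q"] by simp
    also have "\<dots> \<le> s * norm p + s * norm q"
      using that by (intro add_mono mult_right_mono) auto
    also have "\<dots> = s * (norm u + norm v)"
      using that(5) by (simp flip: distrib_left)
    also have "\<dots> < s * (norm u + norm v + 1)" using s by simp
    also have "\<dots> = d" by (simp add: s_def add_nonneg_pos less_imp_neq [symmetric])
    finally show ?thesis by (simp add: dist_norm algebra_simps)
  qed
  obtain a b where ab: "0 \<le> a" "a \<le> s" "0 \<le> b" "b \<le> s"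
    and 1: "F (x + s *\<^sub>R u + s *\<^sub>R v) - F (x + s *\<^sub>R u) - F (x + s *\<^sub>R v) + F x
      = s * s * Fu (x + a *\<^sub>R u + b *\<^sub>R v) v"
    by (rule second_difference_mean_value [OF F Fu, of X s x v])
      (use s close d3 in \<open>auto simp: d_def\<close>)
  obtain a' b' where ab': "0 \<le> a'" "a' \<le> s" "0 \<le> b'" "b' \<le> s"
    and 2: "F (x + s *\<^sub>R v + s *\<^sub>R u) - F (x + s *\<^sub>R v) - F (x + s *\<^sub>R u) + F x
      = s * s * Fv (x + a' *\<^sub>R v + b' *\<^sub>R u) u"
    by (rule second_difference_mean_value [OF F Fv, of X s x u])
      (use s close d3 in \<open>auto simp: d_def\<close>)
  have swap: "x + s *\<^sub>R v + s *\<^sub>R u = x + s *\<^sub>R u + s *\<^sub>R v" by (simp add: algebra_simps)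
  have "s * s * Fu (x + a *\<^sub>R u + b *\<^sub>R v) v = s * s * Fv (x + a' *\<^sub>R v + b' *\<^sub>R u) u"
    using 1 2 unfolding swap by linarith
  then have "Fu (x + a *\<^sub>R u + b *\<^sub>R v) v = Fv (x + a' *\<^sub>R v + b' *\<^sub>R u) u" using s by simp
  moreover have "\<bar>Fu (x + a *\<^sub>R u + b *\<^sub>R v) v - Fu x v\<bar> < e"
    using close [OF ab, of u v] by (intro d1) (simp add: d_def)
  moreover have "\<bar>Fv (x + a' *\<^sub>R v + b' *\<^sub>R u) u - Fv x u\<bar> < e"
    using close [OF ab', of v u] by (intro d2) (simp add: d_def)
  ultimately show False unfolding e_def by (simp add: abs_if split: if_splits)
qed

lemma has_derivative_unique_on_open:
  assumes "open X" "x \<in> X" "\<And>y. y \<in> X \<Longrightarrow> f y = g y"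
    and "(f has_derivative f') (at x)" "(g has_derivative g') (at x)"
  shows "f' = g'"
  using has_derivative_transform_within_open [OF assms(4,1,2,3)] assms(5) has_derivative_unique
  by blast

section \<open>The Levi-Civita connection and its curvature in a chart\<close>

text \<open>
  The curvature at a point enters the argument through its components in a single chart, so its
  symmetries are established chart by chart from the coordinate formulas.
\<close>

locale riemannian_chart =
  fixes G :: "('m::{t2_space, second_countable_topology}, 'n::finite) riem"
    and c :: "('m, 'n) chart"
  assumes riem: "riemannian_manifold G" and chart: "c \<in> atlas G"
begin

definition X :: "(real^'n) set" where "X = coord c ` chart_dom c"

definition dmet :: "real^'n \<Rightarrow> real^'n \<Rightarrow> real^'n^'n" where
  "dmet x h = frechet_derivative (metric G c) (at x) h"

text \<open>The derivative of \<open>y \<mapsto> g\<^sub>y(u, v)\<close> at \<open>x\<close> in the direction \<open>h\<close>, for constant \<open>u\<close>, \<open>v\<close>.\<close>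

definition dg :: "real^'n \<Rightarrow> real^'n \<Rightarrow> real^'n \<Rightarrow> real^'n \<Rightarrow> real" where
  "dg x h u v = u \<bullet> (dmet x h *v v)"

abbreviation g :: "real^'n \<Rightarrow> real^'n \<Rightarrow> real^'n \<Rightarrow> real" where
  "g \<equiv> metric_form G c"

abbreviation \<Gamma> :: "real^'n \<Rightarrow> real^'n \<Rightarrow> real^'n \<Rightarrow> real^'n" where
  "\<Gamma> \<equiv> christoffel G c"

lemma open_X: "open X"
  using riem chart by (simp add: riemannian_manifold_def smooth_atlas_def X_def)

lemma metric_Ck: "Ck_on n X (metric G c)"
  using riem chart by (simp add: riemannian_manifold_def smooth_on_def X_def)

lemma g_sym: "x \<in> X \<Longrightarrow> g x u v = g x v u"
  using riem chart unfolding riemannian_manifold_def X_def by blast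

lemma g_pos: "x \<in> X \<Longrightarrow> u \<noteq> 0 \<Longrightarrow> 0 < g x u u"
  using riem chart unfolding riemannian_manifold_def X_def by blast

lemma g_linear:
  "g x (u + u') v = g x u v + g x u' v" "g x u (v + v') = g x u v + g x u v'"
  "g x (u - u') v = g x u v - g x u' v" "g x u (v - v') = g x u v - g x u v'"
  "g x (a *\<^sub>R u) v = a * g x u v" "g x u (a *\<^sub>R v) = a * g x u v"
  "g x 0 v = 0" "g x u 0 = 0"
  by (simp_all add: metric_form_def inner_add_left inner_add_right inner_diff_left inner_diff_right
      matrix_vector_right_distrib matrix_vector_mult_diff_distrib matrix_vector_mult_scaleR)

lemma met_deriv:
  assumes x: "x \<in> X"
  shows "(metric G c has_derivative dmet x) (at x)"
proof -
  have "metric G c differentiable (at x)"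
    unfolding at_within_open [OF x open_X, symmetric]
    using metric_Ck [of "Suc 0"] x by (simp add: differentiable_on_def)
  then show ?thesis unfolding dmet_def [abs_def] by (rule frechet_derivative_works [THEN iffD1])
qed

lemma dmet_differentiable:
  assumes x: "x \<in> X"
  shows "(\<lambda>y. dmet y h) differentiable (at x)"
proof -
  have "(\<lambda>y. dmet y h) differentiable (at x within X)"
    using metric_Ck [of "Suc (Suc 0)"] x unfolding dmet_def by (simp add: differentiable_on_def)
  then show ?thesis unfolding at_within_open [OF x open_X] .
qed

definition ddmet :: "real^'n \<Rightarrow> real^'n \<Rightarrow> real^'n \<Rightarrow> real^'n^'n" where
  "ddmet x h k = frechet_derivative (\<lambda>y. dmet y h) (at x) k"

lemma dmet_deriv: "x \<in> X \<Longrightarrow> ((\<lambda>y. dmet y h) has_derivative ddmet x h) (at x)"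
  unfolding ddmet_def [abs_def] by (rule frechet_derivative_works [THEN iffD1, OF dmet_differentiable])

lemma ddmet_continuous: "continuous_on X (\<lambda>y. ddmet y h k)"
  using metric_Ck [of "Suc (Suc 0)"] unfolding ddmet_def dmet_def by simp

lemma has_derivative_matrix_form:
  fixes M :: "'a::real_normed_vector \<Rightarrow> real^'k^'j"
  assumes "(M has_derivative D) (at x within S)"
  shows "((\<lambda>y. u \<bullet> (M y *v v)) has_derivative (\<lambda>h. u \<bullet> (D h *v v))) (at x within S)"
  using has_derivative_inner_right [OF has_derivative_matrix_vector_mult [OF assms has_derivative_const [of v]], of u]
  by simp

lemma g_deriv: "x \<in> X \<Longrightarrow> ((\<lambda>y. g y u v) has_derivative (\<lambda>h. dg x h u v)) (at x)"
  unfolding metric_form_def dg_def by (rule has_derivative_matrix_form [OF met_deriv])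

lemma dg_deriv:
  "x \<in> X \<Longrightarrow> ((\<lambda>y. dg y h u v) has_derivative (\<lambda>k. u \<bullet> (ddmet x h k *v v))) (at x)"
  unfolding dg_def by (rule has_derivative_matrix_form [OF dmet_deriv])

lemma dg_linear:
  "dg x h (u + u') v = dg x h u v + dg x h u' v" "dg x h u (v + v') = dg x h u v + dg x h u v'"
  "dg x h (a *\<^sub>R u) v = a * dg x h u v" "dg x h u (a *\<^sub>R v) = a * dg x h u v"
  by (simp_all add: dg_def inner_add_left inner_add_right
      matrix_vector_right_distrib matrix_vector_mult_scaleR)

lemma dg_linear_direction: "x \<in> X \<Longrightarrow> linear (\<lambda>h. dg x h u v)"
  using has_derivative_linear [OF g_deriv] .

lemma dg_sym:
  assumes "x \<in> X"
  shows "dg x h u v = dg x h v u"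
proof -
  have "(\<lambda>h. dg x h u v) = (\<lambda>h. dg x h v u)"
    by (rule has_derivative_unique_on_open [OF open_X assms _ g_deriv g_deriv]) (use assms g_sym in auto)
  then show ?thesis by meson
qed

lemma ddmet_sym:
  assumes x: "x \<in> X"
  shows "w \<bullet> (ddmet x u v *v w) = w \<bullet> (ddmet x v u *v w)"
proof -
  have cont: "continuous (at x) (\<lambda>y. w \<bullet> (ddmet y h k *v w))" for h k
  proof -
    have "continuous_on X (\<lambda>y. w \<bullet> (ddmet y h k *v w))"
      by (intro continuous_intros ddmet_continuous
          bounded_bilinear.continuous_on [OF bounded_bilinear_matrix_vector_mult])
    then show ?thesis using open_X x by (simp add: continuous_on_eq_continuous_at)
  qed
  show ?thesis
    by (rule mixed_partials_commute [OF open_X x g_deriv dg_deriv dg_deriv cont cont])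
qed

lemma frechet_g: "x \<in> X \<Longrightarrow> frechet_derivative (\<lambda>y. g y u v) (at x) = (\<lambda>h. dg x h u v)"
  using frechet_derivative_at [OF g_deriv] by simp

lemma christoffel1_eq:
  "x \<in> X \<Longrightarrow> christoffel1 G c x u v
    = (\<chi> m. (dg x u v (axis m 1) + dg x v u (axis m 1) - dg x (axis m 1) u v) / 2)"
  unfolding christoffel1_def by (simp add: frechet_g)

lemma linear_expansion:
  fixes f :: "real^'n \<Rightarrow> real"
  assumes "linear f"
  shows "f z = (\<Sum>m\<in>UNIV. z $ m * f (axis m 1))"
proof -
  have "f z = f (\<Sum>m\<in>UNIV. z $ m *\<^sub>R axis m 1)"
    using basis_expansion [of z] by (simp add: scalar_mult_eq_scaleR)
  then show ?thesis by (simp add: linear_sum [OF assms] linear_scale [OF assms])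
qed

lemma christoffel1_inner:
  assumes x: "x \<in> X"
  shows "z \<bullet> christoffel1 G c x u v = (dg x u v z + dg x v u z - dg x z u v) / 2"
proof -
  have "linear (\<lambda>z. (dg x u v z + dg x v u z - dg x z u v) / 2)"
    using linear_add [OF dg_linear_direction [OF x]] linear_scale [OF dg_linear_direction [OF x]]
    by (intro linearI) (simp_all add: dg_linear field_simps)
  from linear_expansion [OF this, of z] show ?thesis
    by (simp add: christoffel1_eq [OF x] inner_vec_def)
qed

lemma invertible_metric:
  assumes x: "x \<in> X"
  shows "invertible (metric G c x)"
proof -
  have "u = 0" if "metric G c x *v u = 0" for u
    using g_pos [OF x, of u] that by (cases "u = 0") (auto simp: metric_form_def)
  then show ?thesis by (simp add: invertible_left_inverse matrix_left_invertible_ker)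
qed

text \<open>
  Koszul's formula for fields with constant components, whose brackets vanish. All properties of
  the Christoffel symbols follow from it by nondegeneracy of the metric.
\<close>

lemma koszul:
  assumes x: "x \<in> X"
  shows "g x (\<Gamma> x u v) z = (dg x u v z + dg x v u z - dg x z u v) / 2"
  unfolding g_sym [OF x, of "\<Gamma> x u v"]
  by (simp add: metric_form_def christoffel_def matrix_inv_mult_vec [OF invertible_metric [OF x]]
      christoffel1_inner [OF x])

lemma g_nondegenerate:
  assumes x: "x \<in> X" and "\<And>z. g x u z = g x v z"
  shows "u = v"
  using g_pos [OF x, of "u - v"] assms(2) [of "u - v"] by (cases "u = v") (auto simp: g_linear)

lemma christoffel_sym: "x \<in> X \<Longrightarrow> \<Gamma> x u v = \<Gamma> x v u"
  by (rule g_nondegenerate) (auto simp: koszul [of x] dg_sym [of x _ u v])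

lemma christoffel_add: "x \<in> X \<Longrightarrow> \<Gamma> x u (v + w) = \<Gamma> x u v + \<Gamma> x u w"
  and christoffel_scale: "x \<in> X \<Longrightarrow> \<Gamma> x u (a *\<^sub>R v) = a *\<^sub>R \<Gamma> x u v"
  using linear_add [OF dg_linear_direction [of x]] linear_scale [OF dg_linear_direction [of x]]
  by (auto intro!: g_nondegenerate [of x] simp: koszul g_linear dg_linear field_simps)

lemma metric_compatible:
  "x \<in> X \<Longrightarrow> dg x h u v = g x (\<Gamma> x h u) v + g x u (\<Gamma> x h v)"
  unfolding g_sym [of x u "\<Gamma> x h v"] by (simp add: koszul field_simps dg_sym [of x _ v])

lemma christoffel_differentiable:
  assumes x: "x \<in> X"
  shows "(\<lambda>y. \<Gamma> y u v) differentiable (at x)"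
proof -
  have dg: "(\<lambda>y. dg y h a b) differentiable (at x within X)" for h a b
    by (rule differentiableI [OF has_derivative_at_withinI [OF dg_deriv [OF x]]])
  have "(\<lambda>y. \<chi> m. (dg y u v (axis m 1) + dg y v u (axis m 1) - dg y (axis m 1) u v) / 2)
      differentiable (at x within X)"
    by (rule differentiable_vec_componentwise)
      (simp add: dg differentiable_divide differentiable_diff differentiable_add)
  then have c1: "(\<lambda>y. christoffel1 G c y u v) differentiable (at x within X)"
    unfolding differentiable_def
    by (elim ex_forward) (rule has_derivative_transform [OF x christoffel1_eq])
  have "metric G c differentiable (at x within X)"
    by (rule differentiableI [OF has_derivative_at_withinI [OF met_deriv [OF x]]])
  from differentiable_matrix_inv_mult_vec [OF this c1 invertible_metric x]
  show ?thesis unfolding christoffel_def using at_within_open [OF x open_X] by simp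
qed

definition d\<Gamma> :: "real^'n \<Rightarrow> real^'n \<Rightarrow> real^'n \<Rightarrow> real^'n \<Rightarrow> real^'n" where
  "d\<Gamma> x u v h = frechet_derivative (\<lambda>y. \<Gamma> y u v) (at x) h"

lemma christoffel_deriv: "x \<in> X \<Longrightarrow> ((\<lambda>y. \<Gamma> y u v) has_derivative d\<Gamma> x u v) (at x)"
  unfolding d\<Gamma>_def [abs_def]
  by (rule frechet_derivative_works [THEN iffD1, OF christoffel_differentiable])

lemma d\<Gamma>_sym: "x \<in> X \<Longrightarrow> d\<Gamma> x u v = d\<Gamma> x v u"
  by (rule has_derivative_unique_on_open [OF open_X _ _ christoffel_deriv christoffel_deriv])
    (auto simp: christoffel_sym)

lemma d\<Gamma>_add: "x \<in> X \<Longrightarrow> d\<Gamma> x u (v + w) = (\<lambda>h. d\<Gamma> x u v h + d\<Gamma> x u w h)"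
  by (rule has_derivative_unique_on_open [OF open_X _ _ christoffel_deriv
        has_derivative_add [OF christoffel_deriv christoffel_deriv]])
    (auto simp: christoffel_add)

lemma d\<Gamma>_scale: "x \<in> X \<Longrightarrow> d\<Gamma> x u (a *\<^sub>R v) = (\<lambda>h. a *\<^sub>R d\<Gamma> x u v h)"
  by (rule has_derivative_unique_on_open [OF open_X _ _ christoffel_deriv
        has_derivative_scaleR_right [OF christoffel_deriv]])
    (auto simp: christoffel_scale)

lemma d\<Gamma>_linear: "x \<in> X \<Longrightarrow> linear (d\<Gamma> x u v)"
  using has_derivative_linear [OF christoffel_deriv] .

abbreviation R :: "real^'n \<Rightarrow> real^'n \<Rightarrow> real^'n \<Rightarrow> real^'n \<Rightarrow> real^'n" where
  "R \<equiv> curv_coord G c"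

lemma curv_eq: "R x u v w = d\<Gamma> x v w u - d\<Gamma> x u w v + \<Gamma> x u (\<Gamma> x v w) - \<Gamma> x v (\<Gamma> x u w)"
  by (simp add: curv_coord_def d\<Gamma>_def)

lemma curv_skew: "R x u v w = - R x v u w"
  by (simp add: curv_eq)

lemma curv_bianchi: "x \<in> X \<Longrightarrow> R x u v w + R x v w u + R x w u v = 0"
  by (simp add: curv_eq christoffel_sym [of x w u] christoffel_sym [of x w v] christoffel_sym [of x v u]
      d\<Gamma>_sym [of x w u] d\<Gamma>_sym [of x w v] d\<Gamma>_sym [of x v u])

lemma curv_add_last: "x \<in> X \<Longrightarrow> R x u v (w + z) = R x u v w + R x u v z"
  by (simp add: curv_eq christoffel_add d\<Gamma>_add)

lemma curv_linear_first:
  assumes x: "x \<in> X"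
  shows "linear (\<lambda>u. R x u v w)"
proof (rule linearI)
  fix u u' and a :: real
  note lin = linear_add [OF d\<Gamma>_linear [OF x]] linear_scale [OF d\<Gamma>_linear [OF x]]
  show "R x (u + u') v w = R x u v w + R x u' v w"
    by (simp add: curv_eq lin christoffel_sym [OF x, of _ w] d\<Gamma>_sym [OF x, of _ w]
        christoffel_sym [OF x, of "u + u'"] christoffel_sym [OF x, of u "\<Gamma> x w v"]
        christoffel_sym [OF x, of u' "\<Gamma> x w v"] christoffel_add [OF x] d\<Gamma>_add [OF x])
  show "R x (a *\<^sub>R u) v w = a *\<^sub>R R x u v w"
    by (simp add: curv_eq lin christoffel_sym [OF x, of _ w] d\<Gamma>_sym [OF x, of _ w]
        christoffel_sym [OF x, of "a *\<^sub>R u"] christoffel_sym [OF x, of u "\<Gamma> x w v"]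
        christoffel_scale [OF x] d\<Gamma>_scale [OF x] algebra_simps)
qed

text \<open>
  Since the connection is metric, \<open>\<partial>\<^sub>u \<partial>\<^sub>v g(w, w)\<close> equals \<open>2 g(\<nabla>\<^sub>u\<nabla>\<^sub>v w, w)\<close> plus a term that is symmetric
  in \<open>u\<close> and \<open>v\<close>. Antisymmetrizing leaves \<open>2 g(R(u, v) w, w)\<close> on the right and, by Schwarz's theorem,
  zero on the left.
\<close>

lemma curv_metric_diagonal:
  assumes x: "x \<in> X"
  shows "g x (R x u v w) w = 0"
proof -
  have second: "w \<bullet> (ddmet x v u *v w)
      = 2 * (dg x u (\<Gamma> x v w) w + g x (d\<Gamma> x v w u) w)" for u v
  proof -
    have "((\<lambda>y. 2 * (\<Gamma> y v w \<bullet> (metric G c y *v w))) has_derivative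
        (\<lambda>u. 2 * (\<Gamma> x v w \<bullet> (dmet x u *v w) + d\<Gamma> x v w u \<bullet> (metric G c x *v w)))) (at x)"
      using has_derivative_matrix_vector_mult [OF met_deriv [OF x] has_derivative_const [of w]]
      by (intro has_derivative_mult_right has_derivative_inner christoffel_deriv [OF x]) simp
    moreover have "dg y v w w = 2 * (\<Gamma> y v w \<bullet> (metric G c y *v w))" if "y \<in> X" for y
      using metric_compatible [OF that, of v w w] g_sym [OF that, of w "\<Gamma> y v w"]
      by (simp add: metric_form_def)
    ultimately have "(\<lambda>u. w \<bullet> (ddmet x v u *v w))
        = (\<lambda>u. 2 * (\<Gamma> x v w \<bullet> (dmet x u *v w) + d\<Gamma> x v w u \<bullet> (metric G c x *v w)))"
      by (intro has_derivative_unique_on_open [OF open_X x _ dg_deriv [OF x]])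
    then show ?thesis unfolding dg_def metric_form_def by meson
  qed
  have "dg x u (\<Gamma> x v w) w + g x (d\<Gamma> x v w u) w = dg x v (\<Gamma> x u w) w + g x (d\<Gamma> x u w v) w"
    using ddmet_sym [OF x, of w u v] unfolding second by simp
  then show ?thesis
    unfolding metric_compatible [OF x] curv_eq g_linear
    using g_sym [OF x, of "\<Gamma> x v w" "\<Gamma> x u w"] by simp
qed

lemma curv_metric_skew:
  assumes x: "x \<in> X"
  shows "g x (R x u v w) z = - g x (R x u v z) w"
  using curv_metric_diagonal [OF x, of u v "w + z"] curv_metric_diagonal [OF x, of u v w]
    curv_metric_diagonal [OF x, of u v z] by (simp add: curv_add_last [OF x] g_linear)

text \<open>
  The usual octahedron argument: add the Bianchi identity for the four cyclic arrangements of
  the arguments.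
\<close>

lemma curv_pair_sym:
  assumes x: "x \<in> X"
  shows "g x (R x u v w) z = g x (R x w z u) v"
proof -
  have bianchi: "g x (R x a b d) e + g x (R x b d a) e + g x (R x d a b) e = 0" for a b d e
    using curv_bianchi [OF x, of a b d] by (metis g_linear(1,7))
  have skew: "g x (R x a b d) e = - g x (R x b a d) e" for a b d e
    using curv_skew [of x a b d] g_linear(5) [of x "-1"] by simp
  show ?thesis
    using bianchi [of u v w z] bianchi [of v w z u] bianchi [of w z u v] bianchi [of z u v w]
      curv_metric_skew [OF x, of u v w z] curv_metric_skew [OF x, of v w z u]
      curv_metric_skew [OF x, of w z u v] curv_metric_skew [OF x, of z u v w]
      curv_metric_skew [OF x, of w u v z] curv_metric_skew [OF x, of v z w u]
      skew [of w u z v] skew [of v z w u]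
    by linarith
qed

lemma curv_skew_both: "x \<in> X \<Longrightarrow> g x (R x u v w) z = g x (R x v u z) w"
  using curv_metric_skew [of x u v w z] curv_skew [of x u v z] g_linear(5) [of x "-1"] by simp

text \<open>
  Symmetry of the Jacobi operator \<open>u \<mapsto> R(u, \<tau>) \<tau>\<close>; it makes the Wronskian of two Jacobi fields constant.
\<close>

lemma jacobi_operator_sym: "x \<in> X \<Longrightarrow> g x (R x u \<tau> \<tau>) v = g x (R x v \<tau> \<tau>) u"
  using curv_pair_sym [of x u \<tau> \<tau> v] curv_skew_both [of x \<tau> v u \<tau>] by simp

lemma jacobi_operator_tangential: "x \<in> X \<Longrightarrow> g x (R x u \<tau> \<tau>) \<tau> = 0"
  by (rule curv_metric_diagonal)

lemma jacobi_operator_velocity: "R x \<tau> \<tau> \<tau> = 0"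
  by (simp add: curv_eq)

end

section \<open>Scalar Riccati comparison\<close>

text \<open>
  The solutions of \<open>y'' + k y = 0\<close> with initial data \<open>(0, 1)\<close> and \<open>(1, 0)\<close>. For \<open>k = 0\<close> the definition of
  \<open>cs\<close> yields the constant \<open>cosh 0 = 1\<close>.
\<close>

definition sn :: "real \<Rightarrow> real \<Rightarrow> real" where
  "sn k t = (if k > 0 then sin (sqrt k * t) / sqrt k
             else if k = 0 then t else sinh (sqrt (- k) * t) / sqrt (- k))"

definition cs :: "real \<Rightarrow> real \<Rightarrow> real" where
  "cs k t = (if k > 0 then cos (sqrt k * t) else cosh (sqrt (- k) * t))"

lemma sn_0 [simp]: "sn k 0 = 0" and cs_0 [simp]: "cs k 0 = 1"
  by (simp_all add: sn_def cs_def)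

lemma sn_has_derivative: "(sn k has_real_derivative cs k t) (at t within S)"
  and cs_has_derivative: "(cs k has_real_derivative - k * sn k t) (at t within S)"
proof -
  consider "k > 0" | "k = 0" | "k < 0" by linarith
  then have "(sn k has_real_derivative cs k t) (at t within S) \<and>
    (cs k has_real_derivative - k * sn k t) (at t within S)"
  proof cases
    case 1
    define r where "r = sqrt k"
    have "r > 0" "k = r * r" using 1 by (auto simp: r_def)
    moreover have "sn k = (\<lambda>t. sin (r * t) / r)" "cs k = (\<lambda>t. cos (r * t))"
      using 1 by (auto simp: sn_def cs_def r_def)
    ultimately show ?thesis
      by (auto intro!: derivative_eq_intros simp: field_simps)
  next
    case 2
    then have "sn k = (\<lambda>t. t)" "cs k = (\<lambda>t. 1)" by (auto simp: sn_def cs_def)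
    then show ?thesis using 2 by simp
  next
    case 3
    define r where "r = sqrt (- k)"
    have "r > 0" "- k = r * r" using 3 by (auto simp: r_def)
    moreover have "sn k = (\<lambda>t. sinh (r * t) / r)" "cs k = (\<lambda>t. cosh (r * t))"
      using 3 by (auto simp: sn_def cs_def r_def)
    ultimately show ?thesis
      by (auto intro!: derivative_eq_intros simp: field_simps)
  qed
  then show "(sn k has_real_derivative cs k t) (at t within S)"
    "(cs k has_real_derivative - k * sn k t) (at t within S)" by auto
qed

lemma cs_sn_square: "(cs k t)\<^sup>2 + k * (sn k t)\<^sup>2 = 1"
proof -
  have "((\<lambda>t. (cs k t)\<^sup>2 + k * (sn k t)\<^sup>2) has_real_derivative 0) (at t within UNIV)" for t
    by (auto intro!: derivative_eq_intros sn_has_derivative cs_has_derivative)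
  then obtain c where c: "\<And>t. (cs k t)\<^sup>2 + k * (sn k t)\<^sup>2 = c"
    using has_field_derivative_zero_constant [of UNIV "\<lambda>t. (cs k t)\<^sup>2 + k * (sn k t)\<^sup>2"] by auto
  from c [of 0] c [of t] show ?thesis by simp
qed

text \<open>
  The solution of \<open>y'' + k y = 0\<close> with \<open>y(0) = 1\<close> and \<open>y'(0) = \<mu>\<close>, and its derivative: the factor by which
  Jacobi fields with \<open>J'(0) = \<mu> J(0)\<close> stretch in the space form of curvature \<open>k\<close>.
\<close>

definition warp :: "real \<Rightarrow> real \<Rightarrow> real \<Rightarrow> real" where
  "warp k \<mu> t = cs k t + \<mu> * sn k t"

definition warp' :: "real \<Rightarrow> real \<Rightarrow> real \<Rightarrow> real" where
  "warp' k \<mu> t = - k * sn k t + \<mu> * cs k t"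

lemma warp_0 [simp]: "warp k \<mu> 0 = 1" and warp'_0 [simp]: "warp' k \<mu> 0 = \<mu>"
  by (simp_all add: warp_def warp'_def)

lemma warp_deriv: "(warp k \<mu> has_real_derivative warp' k \<mu> t) (at t within S)"
  unfolding warp_def [abs_def] warp'_def
  by (auto intro!: derivative_eq_intros sn_has_derivative cs_has_derivative)

lemma warp'_deriv: "(warp' k \<mu> has_real_derivative - k * warp k \<mu> t) (at t within S)"
  unfolding warp_def warp'_def [abs_def]
  by (auto intro!: derivative_eq_intros sn_has_derivative cs_has_derivative simp: algebra_simps)

lemma antimono_on_interval:
  fixes f :: "real \<Rightarrow> real"
  assumes der: "\<And>t. t \<in> {a..b} \<Longrightarrow> (f has_real_derivative f' t) (at t within {a..b})"
    and le: "\<And>t. t \<in> {a..b} \<Longrightarrow> f' t \<le> 0" and xy: "a \<le> x" "x \<le> y" "y \<le> b"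
  shows "f y \<le> f x"
proof -
  have "(f has_derivative (*) (f' t)) (at t within {x..y})" if "x \<le> t" "t \<le> y" for t
    using has_field_derivative_subset [OF der, of t "{x..y}"] xy that
    by (auto simp: has_field_derivative_def)
  from mvt_very_simple [OF \<open>x \<le> y\<close> this] obtain \<xi> where "\<xi> \<in> {x..y}" "f y - f x = f' \<xi> * (y - x)"
    by auto
  then show ?thesis using le [of \<xi>] xy by (smt (verit) atLeastAtMost_iff mult_nonpos_nonneg)
qed

lemma real_derivative_unique_within_interval:
  assumes "(f has_real_derivative D) (at t within {a..b})"
    "(f has_real_derivative E) (at t within {a..b})" "a < b" "t \<in> {a..b}"
  shows "D = E"
  using vector_derivative_unique_within_closed_interval [of a b t f D E] assms
  by (auto simp: has_real_derivative_iff_has_vector_derivative)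

text \<open>
  In the application \<open>w\<close> is the \<open>(n-1)\<close>-st root of the volume spanned by the Jacobi fields and \<open>\<phi>\<close> its
  logarithmic derivative, so that \<open>w'' + k w \<le> 0\<close>.
\<close>

locale riccati_supersolution =
  fixes k \<mu> l :: real and w \<phi> \<phi>' :: "real \<Rightarrow> real"
  assumes w_pos: "\<And>t. t \<in> {0..l} \<Longrightarrow> 0 < w t"
    and w_deriv: "\<And>t. t \<in> {0..l} \<Longrightarrow> (w has_real_derivative \<phi> t * w t) (at t within {0..l})"
    and \<phi>_deriv: "\<And>t. t \<in> {0..l} \<Longrightarrow> (\<phi> has_real_derivative \<phi>' t) (at t within {0..l})"
    and riccati: "\<And>t. t \<in> {0..l} \<Longrightarrow> \<phi>' t \<le> - k - (\<phi> t)\<^sup>2"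
    and \<phi>_0: "\<phi> 0 = \<mu>"
begin

abbreviation "f \<equiv> warp k \<mu>"
abbreviation "f' \<equiv> warp' k \<mu>"

text \<open>
  Sturm comparison: the Wronskian \<open>N = w' f - w f'\<close> starts at zero and decreases as long as \<open>f\<close> is
  positive, and \<open>(w / f)' = N / f\<^sup>2\<close>.
\<close>

lemma ratio_antimono_if_pos:
  assumes s: "s \<le> l" and pos: "\<And>t. t \<in> {0..s} \<Longrightarrow> 0 < f t" and xy: "0 \<le> x" "x \<le> y" "y \<le> s"
  shows "w y / f y \<le> w x / f x"
proof (rule antimono_on_interval [where f = "\<lambda>t. w t / f t", OF _ _ xy])
  have sub: "(g has_real_derivative D) (at t within {0..s})"
    if "(g has_real_derivative D) (at t within {0..l})" for g t D
    using that s by (auto intro: has_field_derivative_subset)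
  define N where "N t = \<phi> t * w t * f t - w t * f' t" for t
  fix t assume t: "t \<in> {0..s}"
  have "N t \<le> N 0"
  proof (rule antimono_on_interval [where f = N])
    fix r assume r: "r \<in> {0..s}"
    then have rl: "r \<in> {0..l}" using s by auto
    show "(N has_real_derivative (\<phi>' r + (\<phi> r)\<^sup>2 + k) * w r * f r) (at r within {0..s})"
      unfolding N_def [abs_def]
      by (auto intro!: derivative_eq_intros sub w_deriv \<phi>_deriv warp_deriv warp'_deriv rl
          simp: algebra_simps power2_eq_square)
    show "(\<phi>' r + (\<phi> r)\<^sup>2 + k) * w r * f r \<le> 0"
      using riccati [OF rl] w_pos [OF rl] pos [OF r] by (intro mult_nonpos_nonneg) auto
  qed (use t in auto)
  also have "N 0 = 0" by (simp add: N_def \<phi>_0)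
  finally have N: "N t \<le> 0" .
  have tl: "t \<in> {0..l}" using s t by auto
  show "((\<lambda>t. w t / f t) has_real_derivative N t / (f t)\<^sup>2) (at t within {0..s})"
    unfolding N_def using pos [OF t]
    by (auto intro!: derivative_eq_intros sub w_deriv warp_deriv tl simp: power2_eq_square)
  show "N t / (f t)\<^sup>2 \<le> 0" using N by (simp add: divide_nonpos_nonneg)
qed

text \<open>
  Before the first zero of \<open>f\<close> we have \<open>w \<le> w(0) f\<close>; by continuity \<open>w\<close> would be nonpositive at this zero.
\<close>

lemma f_pos:
  assumes t: "t \<in> {0..l}"
  shows "0 < f t"
proof (rule ccontr)
  assume neg: "\<not> 0 < f t"
  have cont: "continuous_on S f" for S
    using warp_deriv by (meson DERIV_continuous continuous_on_eq_continuous_within)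
  have "\<exists>x\<ge>0. x \<le> t \<and> f x = 0"
    by (rule IVT2') (use neg t warp_0 cont in auto)
  define Z where "Z = {x \<in> {0..t}. f x = 0}"
  have Z: "Z \<noteq> {}" using \<open>\<exists>x\<ge>0. x \<le> t \<and> f x = 0\<close> by (auto simp: Z_def)
  have "compact Z"
    unfolding Z_def using continuous_closed_preimage_constant [OF cont, of "{0..t}" 0]
    by (auto simp: compact_eq_bounded_closed intro: bounded_subset [OF bounded_closed_interval])
  then obtain t1 where t1: "t1 \<in> Z" "\<And>x. x \<in> Z \<Longrightarrow> t1 \<le> x"
    using compact_attains_inf [OF \<open>compact Z\<close> Z] by auto
  have "t1 \<noteq> 0" using t1(1) warp_0 by (auto simp: Z_def)
  with t1(1) have t1_pos: "0 < t1" "t1 \<le> t" "f t1 = 0" by (simp_all add: Z_def)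
  have fpos: "0 < f x" if "0 \<le> x" "x < t1" for x
  proof (rule ccontr)
    assume "\<not> 0 < f x"
    then have "\<exists>y\<ge>0. y \<le> x \<and> f y = 0"
      by (intro IVT2') (use that warp_0 cont in auto)
    then show False using t1(2) that t1_pos by (force simp: Z_def)
  qed
  have "w x - w 0 * f x \<le> 0" if "x \<in> {0..<t1}" for x
    using ratio_antimono_if_pos [of x 0 x] fpos that t1_pos t by (simp add: warp_0 field_simps)
  moreover have "continuous_on {0..t1} (\<lambda>x. w x - w 0 * f x)"
  proof (intro continuous_intros cont)
    show "continuous_on {0..t1} w"
      by (rule continuous_on_subset [OF DERIV_continuous_on [OF w_deriv]]) (use t1_pos t in auto)
  qed
  ultimately have "w t1 - w 0 * f t1 \<le> 0"
    using continuous_le_on_closure [of "{0..<t1}" "\<lambda>x. w x - w 0 * f x" t1 0] t1_pos by auto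
  then show False using w_pos [of t1] t1_pos t by auto
qed

lemma ratio_antimono: "0 \<le> x \<Longrightarrow> x \<le> y \<Longrightarrow> y \<le> l \<Longrightarrow> w y / f y \<le> w x / f x"
  using ratio_antimono_if_pos [of l x y] f_pos by auto

lemma comparison: "t \<in> {0..l} \<Longrightarrow> w t \<le> w 0 * f t"
  using ratio_antimono [of 0 t] f_pos [of t] by (simp add: warp_0 field_simps)

text \<open>
  Positivity of \<open>f\<close> alone already keeps \<open>t\<close> below the first positive zero of \<open>sn k\<close>, because
  \<open>(sn k / f)' = 1 / f\<^sup>2\<close>.
\<close>

lemma sn_pos:
  assumes "t \<in> {0<..l}"
  shows "0 < sn k t"
proof -
  have "((\<lambda>s. sn k s / f s) has_derivative (*) (1 / (f s)\<^sup>2)) (at s within {0..t})"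
    if "0 \<le> s" "s \<le> t" for s
  proof -
    have fs: "0 < f s" using f_pos [of s] assms that by auto
    have "cs k s * f s - sn k s * f' s = 1"
      using cs_sn_square [of k s] by (simp add: warp_def warp'_def algebra_simps power2_eq_square)
    then show ?thesis
      unfolding has_field_derivative_def [symmetric] using fs
      by (auto intro!: derivative_eq_intros sn_has_derivative warp_deriv simp: power2_eq_square)
  qed
  from mvt_very_simple [OF _ this] assms obtain \<xi> where
    xi: "\<xi> \<in> {0..t}" "sn k t / f t = t / (f \<xi>)\<^sup>2" by auto
  have "0 < f \<xi>" "0 < f t" using f_pos xi assms by auto
  then have "0 < sn k t / f t" using assms unfolding xi(2) by simp
  then show ?thesis using \<open>0 < f t\<close> by (simp add: zero_less_divide_iff)
qed

text \<open>
  The quotient \<open>w / f\<close> is monotone and takes the same value at \<open>0\<close> and \<open>t0\<close>, so it is constant on the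
  interval between them, and the Riccati inequality is an equality there.
\<close>

lemma rigidity:
  assumes t0: "t0 \<in> {0<..l}" and eq: "w t0 = w 0 * f t0" and t: "t \<in> {0..t0}"
  shows "\<phi> t = f' t / f t" "\<phi>' t = - k - (\<phi> t)\<^sup>2"
proof -
  have w: "w 0 * f s = w s" if "s \<in> {0..t0}" for s
  proof -
    have "w t0 / f t0 \<le> w s / f s" "w s / f s \<le> w 0 / f 0"
      using ratio_antimono [of s t0] ratio_antimono [of 0 s] that t0 by auto
    moreover have "w t0 / f t0 = w 0" using eq f_pos [of t0] t0 by simp
    ultimately have "w s / f s = w 0" by (simp add: warp_0)
    moreover have "f s > 0" using f_pos [of s] that t0 by auto
    ultimately show ?thesis by (simp add: field_simps)
  qed
  have sub: "(g has_real_derivative D) (at s within {0..t0})"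
    if "(g has_real_derivative D) (at s within {0..l})" for g s D
    using that t0 by (auto intro: has_field_derivative_subset)
  have phi: "f' s / f s = \<phi> s" if s: "s \<in> {0..t0}" for s
  proof -
    have sl: "s \<in> {0..l}" using s t0 by auto
    have "((\<lambda>s. w 0 * f s) has_real_derivative w 0 * f' s) (at s within {0..t0})"
      by (intro DERIV_cmult warp_deriv)
    then have "(w has_real_derivative w 0 * f' s) (at s within {0..t0})"
      unfolding has_field_derivative_def by (rule has_derivative_transform [rotated 2]) (use w s in auto)
    from real_derivative_unique_within_interval [OF this sub [OF w_deriv [OF sl]]]
    have "w 0 * f' s = \<phi> s * (w 0 * f s)" using t0 s w by auto
    then show ?thesis using w_pos [of 0] f_pos [OF sl] s t0 by (simp add: field_simps)
  qed
  show phi_t: "\<phi> t = f' t / f t" using phi [OF t] by simp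
  have tl: "t \<in> {0..l}" using t t0 by auto
  have "((\<lambda>s. f' s / f s) has_real_derivative (- k * f t * f t - f' t * f' t) / (f t * f t))
      (at t within {0..t0})"
    using f_pos [OF tl] by (intro DERIV_divide warp_deriv warp'_deriv) auto
  then have "(\<phi> has_real_derivative (- k * f t * f t - f' t * f' t) / (f t * f t))
      (at t within {0..t0})"
    unfolding has_field_derivative_def by (rule has_derivative_transform [rotated 2]) (use phi t in auto)
  from real_derivative_unique_within_interval [OF sub [OF \<phi>_deriv [OF tl]] this]
  show "\<phi>' t = - k - (\<phi> t)\<^sup>2"
    unfolding phi_t using t0 t f_pos [OF tl] by (simp add: field_simps power2_eq_square)
qed

end

section \<open>Tangent vectors\<close>

definition tcomb :: "('i::finite \<Rightarrow> real) \<Rightarrow> ('i \<Rightarrow> ('m, 'n::finite) tvec) \<Rightarrow> ('m, 'n) tvec" where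
  "tcomb a v = (\<lambda>c. \<Sum>i\<in>UNIV. a i *\<^sub>R v i c)"

lemma chart_at_in: "riemannian_manifold G \<Longrightarrow> chart_at G p \<in> charts_at G p"
proof -
  assume "riemannian_manifold G"
  then have "p \<in> (\<Union>c\<in>atlas G. chart_dom c)"
    by (simp add: riemannian_manifold_def smooth_atlas_def)
  then have "\<exists>c. c \<in> charts_at G p" by (auto simp: charts_at_def)
  then show ?thesis unfolding chart_at_def by (rule someI_ex)
qed

lemma riemannian_chart_at:
  "riemannian_manifold G \<Longrightarrow> c \<in> charts_at G p \<Longrightarrow> riemannian_chart G c"
  by (simp add: riemannian_chart_def charts_at_def)

lemma coord_in_X:
  "riemannian_manifold G \<Longrightarrow> c \<in> charts_at G p \<Longrightarrow> coord c p \<in> riemannian_chart.X c"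
  unfolding riemannian_chart.X_def [OF riemannian_chart_at] by (auto simp: charts_at_def)

lemma ip_eq: "ip G p u v = metric_form G (chart_at G p) (coord (chart_at G p) p)
    (u (chart_at G p)) (v (chart_at G p))"
  by (simp add: ip_def Let_def)

lemma ip_chart:
  assumes "riemannian_manifold G" "c \<in> charts_at G p" "u \<in> tangent_space G p" "v \<in> tangent_space G p"
  shows "ip G p u v = metric_form G c (coord c p) (u c) (v c)"
proof -
  note d = chart_at_in [OF assms(1), of p]
  have t: "w (chart_at G p) = frechet_derivative (transition c (chart_at G p)) (at (coord c p)) (w c)"
    if "w \<in> tangent_space G p" for w
    using that d assms(2) unfolding tangent_space_def by blast
  have "metric_form G c (coord c p) (u c) (v c) = metric_form G (chart_at G p) (coord (chart_at G p) p)
          (frechet_derivative (transition c (chart_at G p)) (at (coord c p)) (u c))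
          (frechet_derivative (transition c (chart_at G p)) (at (coord c p)) (v c))"
    using assms(1,2) d unfolding riemannian_manifold_def by blast
  then show ?thesis
    unfolding ip_eq by (simp flip: t [OF assms(3)] t [OF assms(4)])
qed

lemma transition_linear:
  assumes G: "riemannian_manifold G" and c: "c \<in> charts_at G p" and d: "d \<in> charts_at G p"
  shows "linear (frechet_derivative (transition c d) (at (coord c p)))"
proof (rule linear_frechet_derivative)
  let ?U = "chart_dom c \<inter> chart_dom d"
  have A: "smooth_atlas (atlas G)" "c \<in> atlas G" "d \<in> atlas G" "p \<in> ?U"
    using G c d by (auto simp: riemannian_manifold_def charts_at_def)
  then have sm: "smooth_on (coord c ` ?U) (transition c d)"
    unfolding smooth_atlas_def by blast
  have hom: "homeomorphism (chart_dom c) (coord c ` chart_dom c) (coord c) (chart_inv c)"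
    and op: "open (coord c ` chart_dom c)" "open (chart_dom c)" "open (chart_dom d)"
    using A unfolding smooth_atlas_def by blast+
  have "openin (top_of_set (coord c ` chart_dom c)) (coord c ` ?U)"
    by (rule homeomorphism_imp_open_map [OF hom]) (use op in \<open>simp add: openin_open_Int\<close>)
  then have "open (coord c ` ?U)" using op(1) openin_open_trans by blast
  moreover have "coord c p \<in> coord c ` ?U" using A(4) by blast
  moreover have "transition c d differentiable_on (coord c ` ?U)"
    using sm unfolding smooth_on_def by (metis Ck_on.simps(2))
  ultimately show "transition c d differentiable (at (coord c p))"
    using differentiable_on_eq_differentiable_at by blast
qed

text \<open>
  The transformation law determines all components of a tangent vector from those in one chart.
\<close>

lemma tangent_space_eqI:
  assumes "riemannian_manifold G" "c \<in> charts_at G p" "u \<in> tangent_space G p" "v \<in> tangent_space G p"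
    "u c = v c"
  shows "u = v"
proof
  fix d show "u d = v d"
  proof (cases "d \<in> charts_at G p")
    case True
    with assms(2-4) have "u d = frechet_derivative (transition c d) (at (coord c p)) (u c)"
      "v d = frechet_derivative (transition c d) (at (coord c p)) (v c)"
      unfolding tangent_space_def by blast+
    with assms(5) show ?thesis by simp
  next
    case False
    with assms(3,4) have "u d = 0" "v d = 0" unfolding tangent_space_def by blast+
    then show ?thesis by simp
  qed
qed

lemma tcomb_in_tangent_space:
  assumes "riemannian_manifold G" and v: "\<And>i. v i \<in> tangent_space G p"
  shows "tcomb a v \<in> tangent_space G p"
  unfolding tangent_space_def tcomb_def
proof (intro CollectI conjI allI impI ballI)
  fix c assume "c \<notin> charts_at G p"
  then have "v i c = 0" for i using v [of i] unfolding tangent_space_def by blast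
  then show "(\<Sum>i\<in>UNIV. a i *\<^sub>R v i c) = 0" by simp
next
  fix c d assume cd: "c \<in> charts_at G p" "d \<in> charts_at G p"
  note lin = transition_linear [OF assms(1) cd]
  have "v i d = frechet_derivative (transition c d) (at (coord c p)) (v i c)" for i
    using v [of i] cd unfolding tangent_space_def by blast
  then show "(\<Sum>i\<in>UNIV. a i *\<^sub>R v i d)
      = frechet_derivative (transition c d) (at (coord c p)) (\<Sum>i\<in>UNIV. a i *\<^sub>R v i c)"
    by (simp add: linear_sum [OF lin] linear_scale [OF lin])
qed

lemma tscale_in_tangent_space:
  assumes "riemannian_manifold G" "u \<in> tangent_space G p"
  shows "tscale a u \<in> tangent_space G p"
  using tcomb_in_tangent_space [OF assms(1), of "\<lambda>_ :: unit. u" p "\<lambda>_. a"] assms(2)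
  by (simp add: tcomb_def tscale_def UNIV_unit)

lemma tadd_in_tangent_space:
  assumes "riemannian_manifold G" "u \<in> tangent_space G p" "v \<in> tangent_space G p"
  shows "tadd u v \<in> tangent_space G p"
  using tcomb_in_tangent_space [OF assms(1), of "\<lambda>i. if i then u else v" p "\<lambda>_. 1"] assms(2,3)
  by (simp add: tcomb_def tadd_def UNIV_bool add.commute)

lemma tzero_in_tangent_space:
  assumes "riemannian_manifold G"
  shows "tzero \<in> tangent_space G p"
  unfolding tangent_space_def tzero_def
  by (simp add: linear_0 [OF transition_linear [OF assms]])

context
  fixes G :: "('m::{t2_space, second_countable_topology}, 'n::finite) riem" and p :: 'm
  assumes G: "riemannian_manifold G"
begin

interpretation riemannian_chart G "chart_at G p"
  using riemannian_chart_at [OF G chart_at_in [OF G]] .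

lemma ip_sym: "ip G p u v = ip G p v u"
  unfolding ip_eq by (rule g_sym [OF coord_in_X [OF G chart_at_in [OF G]]])

lemma ip_add_left: "ip G p (tadd u u') v = ip G p u v + ip G p u' v"
  by (simp add: ip_eq tadd_def g_linear)

lemma ip_add_right: "ip G p v (tadd u u') = ip G p v u + ip G p v u'"
  by (simp add: ip_eq tadd_def g_linear)

lemma ip_scale: "ip G p (tscale a u) v = a * ip G p u v" "ip G p u (tscale a v) = a * ip G p u v"
  by (simp_all add: ip_eq tscale_def g_linear)

lemma ip_tcomb_left: "ip G p (tcomb a v) w = (\<Sum>i\<in>UNIV. a i * ip G p (v i) w)"
proof -
  have lin: "linear (\<lambda>u. g (coord (chart_at G p) p) u (w (chart_at G p)))"
    by (intro linearI) (simp_all add: g_linear)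
  show ?thesis by (simp add: ip_eq tcomb_def linear_sum [OF lin] g_linear)
qed

lemma ip_tcomb_right: "ip G p w (tcomb a v) = (\<Sum>i\<in>UNIV. a i * ip G p w (v i))"
  using ip_tcomb_left by (simp add: ip_sym [of w])

lemma ip_pos:
  assumes "u \<in> tangent_space G p" "u \<noteq> tzero"
  shows "0 < ip G p u u"
proof -
  have "u (chart_at G p) \<noteq> 0"
    using tangent_space_eqI [OF G chart_at_in [OF G] assms(1)
        tzero_in_tangent_space [OF G]] assms(2) by (auto simp: tzero_def)
  then show ?thesis
    unfolding ip_eq by (rule g_pos [OF coord_in_X [OF G chart_at_in [OF G]]])
qed

lemma ip_zero: "ip G p tzero u = 0" "ip G p u tzero = 0"
  by (simp_all add: ip_eq tzero_def g_linear)

lemma ip_curv_sym: "ip G p (curv G p u \<tau> \<tau>) v = ip G p (curv G p v \<tau> \<tau>) u"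
  using jacobi_operator_sym [OF coord_in_X [OF G chart_at_in [OF G]]] chart_at_in [OF G]
  by (simp add: ip_eq curv_def)

lemma ip_curv_tangential: "ip G p (curv G p u \<tau> \<tau>) \<tau> = 0"
  using jacobi_operator_tangential [OF coord_in_X [OF G chart_at_in [OF G]]] chart_at_in [OF G]
  by (simp add: ip_eq curv_def)

lemma ip_curv_skew_both: "ip G p (curv G p \<tau> u u) \<tau> = ip G p (curv G p u \<tau> \<tau>) u"
  using curv_skew_both [OF coord_in_X [OF G chart_at_in [OF G]]] chart_at_in [OF G]
  by (simp add: ip_eq curv_def)

lemma curv_tcomb: "curv G p (tcomb a v) \<tau> \<sigma> = tcomb a (\<lambda>i. curv G p (v i) \<tau> \<sigma>)"
proof
  fix c
  show "curv G p (tcomb a v) \<tau> \<sigma> c = tcomb a (\<lambda>i. curv G p (v i) \<tau> \<sigma>) c"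
  proof (cases "c \<in> charts_at G p")
    case True
    have lin: "linear (\<lambda>u. curv_coord G c (coord c p) u (\<tau> c) (\<sigma> c))"
      by (rule riemannian_chart.curv_linear_first [OF riemannian_chart_at [OF G True] coord_in_X [OF G True]])
    from True show ?thesis
      by (simp add: curv_def tcomb_def linear_sum [OF lin] linear_scale [OF lin])
  qed (simp add: curv_def tcomb_def)
qed

context
  fixes \<tau> :: "('m, 'n) tvec" and v :: "'i::finite \<Rightarrow> ('m, 'n) tvec"
  assumes card: "CARD('n) = CARD('i) + 1"
    and unit: "ip G p \<tau> \<tau> = 1" and orth: "\<And>i. ip G p \<tau> (v i) = 0"
    and tangent: "\<And>i. v i \<in> tangent_space G p"
    and indep: "\<And>a. tcomb a v = tzero \<Longrightarrow> a = (\<lambda>_. 0)"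
begin

text \<open>
  The vectors \<open>v i\<close> together with \<open>\<tau>\<close>, which is placed at index \<open>None\<close>, in the coordinates of the chart
  in which scalar products and curvature are evaluated.
\<close>

definition frame_vector :: "'i option \<Rightarrow> real^'n" where
  "frame_vector j = (case j of None \<Rightarrow> \<tau> | Some i \<Rightarrow> v i) (chart_at G p)"

lemma sum_UNIV_option: "(\<Sum>j\<in>UNIV. f j) = f None + (\<Sum>i\<in>(UNIV :: 'i set). f (Some i))"
  for f :: "'i option \<Rightarrow> 'b::comm_monoid_add"
  by (simp add: UNIV_option_conv sum.reindex)

lemma frame_vector_indep:
  assumes "(\<Sum>j\<in>UNIV. a j *\<^sub>R frame_vector j) = 0"
  shows "a = (\<lambda>_. 0)"
proof -
  let ?t = "tadd (tscale (a None) \<tau>) (tcomb (\<lambda>i. a (Some i)) v)"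
  have t: "?t (chart_at G p) = 0"
    using assms by (simp add: sum_UNIV_option frame_vector_def tadd_def tscale_def tcomb_def)
  then have "ip G p \<tau> ?t = 0" by (simp add: ip_eq g_linear)
  then have a0: "a None = 0"
    by (simp add: ip_add_right ip_scale ip_tcomb_right unit orth)
  with t have "tcomb (\<lambda>i. a (Some i)) v (chart_at G p) = 0" by (simp add: tadd_def tscale_def)
  then have "tcomb (\<lambda>i. a (Some i)) v = tzero"
    using tangent_space_eqI [OF G chart_at_in [OF G] tcomb_in_tangent_space [OF G tangent]
        tzero_in_tangent_space [OF G]] by (simp add: tzero_def)
  from indep [OF this] a0 have "a j = 0" for j by (cases j) (auto dest: fun_cong)
  then show ?thesis by auto
qed

lemma frame_card: "CARD('i option) = CARD('n)"
  using card by simp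

text \<open>
  The conclusion concerns one chart only since \<open>w\<close> need not obey the transformation law of
  tangent vectors. It will be applied to curvature vectors, which are defined chart by chart.
\<close>

lemma orthogonal_to_frame:
  assumes w: "ip G p w \<tau> = 0" "\<And>i. ip G p w (v i) = 0"
  shows "w (chart_at G p) = 0"
proof (rule ccontr)
  assume "w (chart_at G p) \<noteq> 0"
  then have pos: "0 < ip G p w w"
    unfolding ip_eq by (rule g_pos [OF coord_in_X [OF G chart_at_in [OF G]]])
  obtain a where "w (chart_at G p) = (\<Sum>j\<in>UNIV. a j *\<^sub>R frame_vector j)"
    using independent_family_spans [OF frame_card frame_vector_indep] by blast
  then have "w (chart_at G p)
      = tadd (tscale (a None) \<tau>) (tcomb (\<lambda>i. a (Some i)) v) (chart_at G p)"
    by (simp add: sum_UNIV_option frame_vector_def tadd_def tscale_def tcomb_def)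
  then have "ip G p w w = ip G p w (tadd (tscale (a None) \<tau>) (tcomb (\<lambda>i. a (Some i)) v))"
    by (simp add: ip_eq)
  also have "\<dots> = 0" by (simp add: ip_add_right ip_scale ip_tcomb_right w)
  finally show False using pos by simp
qed

text \<open>
  The direction \<open>\<tau>\<close> contributes nothing to the trace because \<open>R(\<tau>, \<tau>) \<tau> = 0\<close>.
\<close>

lemma Ric_frame:
  assumes N: "\<And>i. curv G p (v i) \<tau> \<tau> (chart_at G p) = tcomb (N i) v (chart_at G p)"
  shows "Ric G p \<tau> \<tau> = (\<Sum>i\<in>UNIV. N i i)"
proof -
  let ?c = "chart_at G p"
  let ?L = "\<lambda>u. curv_coord G ?c (coord ?c p) u (\<tau> ?c) (\<tau> ?c)"
  define N' :: "'i option \<Rightarrow> 'i option \<Rightarrow> real" where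
    "N' i j = (case i of None \<Rightarrow> 0 | Some i \<Rightarrow> (case j of None \<Rightarrow> 0 | Some j \<Rightarrow> N i j))" for i j
  have lin: "linear ?L"
    by (rule curv_linear_first [OF coord_in_X [OF G chart_at_in [OF G]]])
  have frame: "?L (frame_vector j) = (\<Sum>i\<in>UNIV. N' j i *\<^sub>R frame_vector i)" for j
  proof (cases j)
    case None
    then show ?thesis by (simp add: frame_vector_def N'_def jacobi_operator_velocity)
  next
    case (Some i)
    with N [of i] chart_at_in [OF G, of p] show ?thesis
      by (simp add: frame_vector_def N'_def sum_UNIV_option curv_def tcomb_def)
  qed
  have "trace (matrix ?L) = (\<Sum>j\<in>UNIV. N' j j)"
    by (rule trace_matrix_in_basis [OF lin frame_card frame_vector_indep frame])
  then show ?thesis by (simp add: Ric_def Let_def sum_UNIV_option N'_def)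
qed

end

end

section \<open>Vector fields along a geodesic\<close>

text \<open>
  Derivatives are taken within \<open>I\<close>, so values of a field outside \<open>I\<close> are irrelevant even at its end points.
\<close>

lemma cov_deriv_cong:
  assumes "\<And>r. r \<in> I \<Longrightarrow> V r = W r" "t \<in> I"
  shows "cov_deriv G I \<gamma> V t = cov_deriv G I \<gamma> W t"
proof -
  have "((\<lambda>s. V s c) has_vector_derivative d) (at t within I)
      \<longleftrightarrow> ((\<lambda>s. W s c) has_vector_derivative d) (at t within I)" for c d
    using has_vector_derivative_transform [OF assms(2), of "\<lambda>s. V s c" "\<lambda>s. W s c" d]
      has_vector_derivative_transform [OF assms(2), of "\<lambda>s. W s c" "\<lambda>s. V s c" d] assms(1) by auto
  then have "vector_derivative (\<lambda>s. V s c) (at t within I)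
      = vector_derivative (\<lambda>s. W s c) (at t within I)" for c
    unfolding vector_derivative_def by presburger
  moreover have "V t = W t" using assms by simp
  ultimately show ?thesis by (simp add: cov_deriv_def fun_eq_iff)
qed

lemma differentiable_field_cong:
  assumes W: "differentiable_field G I \<gamma> W" and eq: "\<And>r. r \<in> I \<Longrightarrow> V r = W r"
  shows "differentiable_field G I \<gamma> V"
  unfolding differentiable_field_def
proof (intro ballI conjI)
  fix t assume t: "t \<in> I"
  then show "V t \<in> tangent_space G (\<gamma> t)"
    using W eq unfolding differentiable_field_def by auto
  fix c assume "c \<in> charts_at G (\<gamma> t)"
  with W t have "(\<lambda>s. W s c) differentiable (at t within I)"
    unfolding differentiable_field_def by blast
  then obtain d where "((\<lambda>s. W s c) has_derivative d) (at t within I)"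
    unfolding differentiable_def by blast
  then have "((\<lambda>s. V s c) has_derivative d) (at t within I)"
    by (rule has_derivative_transform [rotated 2]) (use t eq in auto)
  then show "(\<lambda>s. V s c) differentiable (at t within I)" by (rule differentiableI)
qed

locale geodesic_segment =
  fixes G :: "('m::{t2_space, second_countable_topology}, 'n::finite) riem"
    and \<gamma> :: "real \<Rightarrow> 'm" and l :: real
  assumes G: "riemannian_manifold G" and l: "0 < l" and geod: "normal_geodesic G {0..l} \<gamma>"
begin

abbreviation "T \<equiv> velocity G {0..l} \<gamma>"
abbreviation "D \<equiv> cov_deriv G {0..l} \<gamma>"
abbreviation "field \<equiv> differentiable_field G {0..l} \<gamma>"

lemma curve: "differentiable_curve G {0..l} \<gamma>"
  and T_field: "field T"
  and T_parallel: "t \<in> {0..l} \<Longrightarrow> D T t = tzero"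
  and T_unit: "t \<in> {0..l} \<Longrightarrow> ip G (\<gamma> t) (T t) (T t) = 1"
  using geod by (auto simp: normal_geodesic_def geodesic_def parallel_field_def tnorm_def)

lemma field_tangent: "field V \<Longrightarrow> t \<in> {0..l} \<Longrightarrow> V t \<in> tangent_space G (\<gamma> t)"
  unfolding differentiable_field_def by blast

lemma velocity_vderiv:
  assumes "t \<in> {0..l}" "c \<in> charts_at G (\<gamma> t)"
  shows "((\<lambda>s. coord c (\<gamma> s)) has_vector_derivative T t c) (at t within {0..l})"
proof -
  have "(\<lambda>s. coord c (\<gamma> s)) differentiable (at t within {0..l})"
    using curve assms unfolding differentiable_curve_def by blast
  then show ?thesis using assms by (simp add: velocity_def vector_derivative_works)
qed

lemma field_vderiv:
  assumes "field V" "t \<in> {0..l}" "c \<in> charts_at G (\<gamma> t)"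
  shows "((\<lambda>s. V s c) has_vector_derivative
      (D V t c - christoffel G c (coord c (\<gamma> t)) (T t c) (V t c))) (at t within {0..l})"
proof -
  have "(\<lambda>s. V s c) differentiable (at t within {0..l})"
    using assms unfolding differentiable_field_def by blast
  then show ?thesis using assms by (simp add: cov_deriv_def vector_derivative_works)
qed

text \<open>
  The connection is metric. Near \<open>t\<close> the curve stays in the chart chosen at \<open>\<gamma> t\<close>, and the scalar product
  may be computed there although it refers to a different chart at each point of the curve.
\<close>

lemma ip_deriv:
  assumes V: "field V" and W: "field W" and t: "t \<in> {0..l}"
  shows "((\<lambda>s. ip G (\<gamma> s) (V s) (W s)) has_real_derivative
      ip G (\<gamma> t) (D V t) (W t) + ip G (\<gamma> t) (V t) (D W t)) (at t within {0..l})"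
proof -
  define c where "c = chart_at G (\<gamma> t)"
  have c: "c \<in> charts_at G (\<gamma> t)" unfolding c_def by (rule chart_at_in [OF G])
  interpret riemannian_chart G c by (rule riemannian_chart_at [OF G c])
  define x where "x = coord c (\<gamma> t)"
  have x: "x \<in> X" unfolding x_def by (rule coord_in_X [OF G c])
  define v' where "v' = D V t c - \<Gamma> x (T t c) (V t c)"
  define w' where "w' = D W t c - \<Gamma> x (T t c) (W t c)"
  have dV: "((\<lambda>s. V s c) has_derivative (\<lambda>h. h *\<^sub>R v')) (at t within {0..l})"
    and dW: "((\<lambda>s. W s c) has_derivative (\<lambda>h. h *\<^sub>R w')) (at t within {0..l})"
    and d\<gamma>: "((\<lambda>s. coord c (\<gamma> s)) has_derivative (\<lambda>h. h *\<^sub>R T t c)) (at t within {0..l})"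
    using field_vderiv [OF V t c] field_vderiv [OF W t c] velocity_vderiv [OF t c]
    by (simp_all add: has_vector_derivative_def v'_def w'_def x_def)
  have dm: "((\<lambda>s. metric G c (coord c (\<gamma> s))) has_derivative (\<lambda>h. dmet x (h *\<^sub>R T t c)))
      (at t within {0..l})"
    by (rule has_derivative_compose [OF d\<gamma>]) (use met_deriv [OF x] in \<open>simp add: x_def\<close>)
  have "((\<lambda>s. V s c \<bullet> (metric G c (coord c (\<gamma> s)) *v W s c)) has_derivative
      (\<lambda>h. V t c \<bullet> (metric G c x *v (h *\<^sub>R w') + dmet x (h *\<^sub>R T t c) *v W t c)
        + (h *\<^sub>R v') \<bullet> (metric G c x *v W t c))) (at t within {0..l})"
    using has_derivative_inner [OF dV has_derivative_matrix_vector_mult [OF dm dW]]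
    by (simp add: x_def)
  moreover have "V t c \<bullet> (metric G c x *v (h *\<^sub>R w') + dmet x (h *\<^sub>R T t c) *v W t c)
        + (h *\<^sub>R v') \<bullet> (metric G c x *v W t c)
      = (g x (D V t c) (W t c) + g x (V t c) (D W t c)) * h" for h
  proof -
    have "V t c \<bullet> (dmet x (h *\<^sub>R T t c) *v W t c) = h * dg x (T t c) (V t c) (W t c)"
      using linear_scale [OF dg_linear_direction [OF x]] by (simp add: dg_def)
    then show ?thesis
      by (simp add: inner_add_right matrix_vector_mult_scaleR v'_def w'_def algebra_simps
          metric_compatible [OF x] flip: metric_form_def)
        (simp add: g_linear algebra_simps)
  qed
  ultimately have "((\<lambda>s. g (coord c (\<gamma> s)) (V s c) (W s c)) has_derivative
      (*) (g x (D V t c) (W t c) + g x (V t c) (D W t c))) (at t within {0..l})"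
    by (simp add: metric_form_def)
  moreover have "\<forall>\<^sub>F s in at t within {0..l}. g (coord c (\<gamma> s)) (V s c) (W s c) = ip G (\<gamma> s) (V s) (W s)"
  proof -
    have "(\<gamma> \<longlongrightarrow> \<gamma> t) (at t within {0..l})"
      using curve t by (simp add: differentiable_curve_def continuous_on_def)
    moreover have "open (chart_dom c)" "\<gamma> t \<in> chart_dom c" "c \<in> atlas G"
      using G c by (auto simp: riemannian_manifold_def smooth_atlas_def charts_at_def)
    ultimately have "\<forall>\<^sub>F s in at t within {0..l}. \<gamma> s \<in> chart_dom c"
      by (auto dest: topological_tendstoD)
    moreover have "\<forall>\<^sub>F s in at t within {0..l}. s \<in> {0..l}"
      by (simp add: eventually_at_filter)
    ultimately show ?thesis
    proof eventually_elim
      case (elim s)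
      then have "c \<in> charts_at G (\<gamma> s)" using \<open>c \<in> atlas G\<close> by (simp add: charts_at_def)
      from ip_chart [OF G this field_tangent [OF V] field_tangent [OF W]] elim show ?case by simp
    qed
  qed
  moreover have "g (coord c (\<gamma> t)) (V t c) (W t c) = ip G (\<gamma> t) (V t) (W t)"
    by (simp add: ip_eq c_def)
  ultimately have "((\<lambda>s. ip G (\<gamma> s) (V s) (W s)) has_derivative
      (*) (g x (D V t c) (W t c) + g x (V t c) (D W t c))) (at t within {0..l})"
    by (rule has_derivative_transform_eventually) (rule t)
  then show ?thesis by (simp add: has_field_derivative_def ip_eq c_def x_def)
qed

text \<open>
  Focal points and the parallel fields of the equality case live on subintervals \<open>{0..s}\<close>; passing to
  one changes neither velocity nor covariant derivative.
\<close>

lemma cov_deriv_restrict_eq: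
  assumes s: "0 < s" "s \<le> l" and t: "t \<in> {0..s}" and c: "c \<in> charts_at G (\<gamma> t)"
    and d: "((\<lambda>r. V r c) has_vector_derivative d) (at t within {0..s})"
  shows "cov_deriv G {0..s} \<gamma> V t c = d + christoffel G c (coord c (\<gamma> t)) (T t c) (V t c)"
proof -
  have tl: "t \<in> {0..l}" "{0..s} \<subseteq> {0..l}" using s t by auto
  have "velocity G {0..s} \<gamma> t c = T t c"
    using vector_derivative_within_closed_interval [of 0 s t] s t c
      has_vector_derivative_within_subset [OF velocity_vderiv [OF tl(1) c] tl(2)]
    by (simp add: velocity_def)
  moreover have "vector_derivative (\<lambda>r. V r c) (at t within {0..s}) = d"
    using vector_derivative_within_closed_interval [of 0 s t] s t d by simp
  ultimately show ?thesis using c by (simp add: cov_deriv_def)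
qed

lemma tcomb_vderiv:
  assumes V: "\<And>i. field (V i)" and t: "t \<in> {0..l}" and c: "c \<in> charts_at G (\<gamma> t)"
  shows "((\<lambda>r. tcomb a (\<lambda>i. V i r) c) has_vector_derivative
      (tcomb a (\<lambda>i. D (V i) t) c
        - christoffel G c (coord c (\<gamma> t)) (T t c) (tcomb a (\<lambda>i. V i t) c))) (at t within {0..l})"
proof -
  interpret riemannian_chart G c by (rule riemannian_chart_at [OF G c])
  have x: "coord c (\<gamma> t) \<in> X" by (rule coord_in_X [OF G c])
  have lin: "linear (\<Gamma> (coord c (\<gamma> t)) (T t c))"
    by (intro linearI) (simp_all add: christoffel_add [OF x] christoffel_scale [OF x])
  have "((\<lambda>r. \<Sum>i\<in>UNIV. a i *\<^sub>R V i r c) has_vector_derivative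
      (\<Sum>i\<in>UNIV. a i *\<^sub>R (D (V i) t c - \<Gamma> (coord c (\<gamma> t)) (T t c) (V i t c)))) (at t within {0..l})"
    by (intro has_vector_derivative_sum bounded_linear.has_vector_derivative
        [OF bounded_linear_scaleR_right] field_vderiv [OF V t c])
  then show ?thesis
    by (simp add: tcomb_def linear_sum [OF lin] linear_scale [OF lin] scaleR_diff_right sum_subtractf)
qed

lemma cov_deriv_tcomb:
  assumes V: "\<And>i. field (V i)" and s: "0 < s" "s \<le> l" and t: "t \<in> {0..s}"
  shows "cov_deriv G {0..s} \<gamma> (\<lambda>t. tcomb a (\<lambda>i. V i t)) t = tcomb a (\<lambda>i. D (V i) t)"
proof
  fix c
  have tl: "t \<in> {0..l}" "{0..s} \<subseteq> {0..l}" using s t by auto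
  show "cov_deriv G {0..s} \<gamma> (\<lambda>t. tcomb a (\<lambda>i. V i t)) t c = tcomb a (\<lambda>i. D (V i) t) c"
  proof (cases "c \<in> charts_at G (\<gamma> t)")
    case True
    from cov_deriv_restrict_eq [where V = "\<lambda>t. tcomb a (\<lambda>i. V i t)", OF s t True
        has_vector_derivative_within_subset [OF tcomb_vderiv [of V t c a, OF V tl(1) True] tl(2)]]
    show ?thesis by simp
  next
    case False
    then show ?thesis by (simp add: cov_deriv_def tcomb_def)
  qed
qed

lemma tcomb_field:
  assumes V: "\<And>i. field (V i)" and s: "0 < s" "s \<le> l"
  shows "differentiable_field G {0..s} \<gamma> (\<lambda>t. tcomb a (\<lambda>i. V i t))"
  unfolding differentiable_field_def
proof (intro ballI conjI)
  fix t assume "t \<in> {0..s}"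
  then have t: "t \<in> {0..l}" "{0..s} \<subseteq> {0..l}" using s by auto
  show "tcomb a (\<lambda>i. V i t) \<in> tangent_space G (\<gamma> t)"
    by (rule tcomb_in_tangent_space [OF G field_tangent [OF V t(1)]])
  show "(\<lambda>t. tcomb a (\<lambda>i. V i t) c) differentiable (at t within {0..s})"
    if "c \<in> charts_at G (\<gamma> t)" for c
    by (rule differentiableI_vector [OF has_vector_derivative_within_subset
          [OF tcomb_vderiv [OF V t(1) that] t(2)]])
qed

lemma jacobi_field_D:
  assumes "jacobi_field G {0..l} \<gamma> J"
  shows "field J" "field (D J)"
    "t \<in> {0..l} \<Longrightarrow> D (D J) t = tscale (-1) (curv G (\<gamma> t) (J t) (T t) (T t))"
proof -
  show "field J" "field (D J)" using assms by (auto simp: jacobi_field_def)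
  assume "t \<in> {0..l}"
  then have "tadd (D (D J) t) (curv G (\<gamma> t) (J t) (T t) (T t)) = tzero"
    using assms by (auto simp: jacobi_field_def)
  then show "D (D J) t = tscale (-1) (curv G (\<gamma> t) (J t) (T t) (T t))"
    by (auto simp: fun_eq_iff tadd_def tscale_def tzero_def eq_neg_iff_add_eq_0)
qed

lemma velocity_restrict:
  assumes s: "0 < s" "s \<le> l" and t: "t \<in> {0..s}"
  shows "velocity G {0..s} \<gamma> t = T t"
proof
  fix c
  have tl: "t \<in> {0..l}" "{0..s} \<subseteq> {0..l}" using s t by auto
  show "velocity G {0..s} \<gamma> t c = T t c"
  proof (cases "c \<in> charts_at G (\<gamma> t)")
    case True
    then show ?thesis
      using vector_derivative_within_closed_interval [of 0 s t] s t
        has_vector_derivative_within_subset [OF velocity_vderiv [OF tl(1) True] tl(2)]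
      by (simp add: velocity_def)
  qed (simp add: velocity_def)
qed

text \<open>
  The Jacobi equation is linear. This is how a linear dependence among Jacobi fields
  produces a focal point.
\<close>

lemma jacobi_field_combination:
  assumes V: "\<And>i. jacobi_field G {0..l} \<gamma> (V i)" and s: "0 < s" "s \<le> l"
  shows "jacobi_field G {0..s} \<gamma> (\<lambda>t. tcomb a (\<lambda>i. V i t))"
  unfolding jacobi_field_def
proof (intro conjI ballI)
  note V1 = jacobi_field_D(1) [OF V] and V2 = jacobi_field_D(2) [OF V]
  let ?D = "cov_deriv G {0..s} \<gamma> (\<lambda>t. tcomb a (\<lambda>i. V i t))"
  have D: "?D t = tcomb a (\<lambda>i. D (V i) t)" if "t \<in> {0..s}" for t
    by (rule cov_deriv_tcomb [OF V1 s that])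
  show "differentiable_field G {0..s} \<gamma> (\<lambda>t. tcomb a (\<lambda>i. V i t))"
    by (rule tcomb_field [OF V1 s])
  have "differentiable_field G {0..s} \<gamma> (\<lambda>t. tcomb a (\<lambda>i. D (V i) t))"
    by (rule tcomb_field [OF V2 s])
  then show "differentiable_field G {0..s} \<gamma> ?D"
    by (rule differentiable_field_cong) (rule D)
  fix t assume t: "t \<in> {0..s}"
  have "cov_deriv G {0..s} \<gamma> ?D t = cov_deriv G {0..s} \<gamma> (\<lambda>t. tcomb a (\<lambda>i. D (V i) t)) t"
    by (rule cov_deriv_cong [OF D t])
  also have "\<dots> = tcomb a (\<lambda>i. D (D (V i)) t)"
    by (rule cov_deriv_tcomb [OF V2 s t])
  finally have DD: "cov_deriv G {0..s} \<gamma> ?D t = tcomb a (\<lambda>i. D (D (V i)) t)" .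
  have "t \<in> {0..l}" using s t by auto
  then show "tadd (cov_deriv G {0..s} \<gamma> ?D t) (curv G (\<gamma> t) (tcomb a (\<lambda>i. V i t))
      (velocity G {0..s} \<gamma> t) (velocity G {0..s} \<gamma> t)) = tzero"
    unfolding DD velocity_restrict [OF s t] curv_tcomb [OF G]
    by (simp add: jacobi_field_D(3) [OF V] tcomb_def tscale_def tadd_def tzero_def sum_negf)
qed

lemma tscale_restrict:
  assumes V: "field V" and s: "0 < s" "s \<le> l"
    and q: "\<And>t. t \<in> {0..s} \<Longrightarrow> (q has_real_derivative q' t) (at t within {0..s})"
  shows "differentiable_field G {0..s} \<gamma> (\<lambda>t. tscale (q t) (V t))"
    and "t \<in> {0..s} \<Longrightarrow> cov_deriv G {0..s} \<gamma> (\<lambda>t. tscale (q t) (V t)) t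
      = tadd (tscale (q' t) (V t)) (tscale (q t) (D V t))"
proof -
  have vderiv: "((\<lambda>r. tscale (q r) (V r) c) has_vector_derivative
      (q t *\<^sub>R (D V t c - christoffel G c (coord c (\<gamma> t)) (T t c) (V t c)) + q' t *\<^sub>R V t c))
      (at t within {0..s})" if t: "t \<in> {0..s}" and c: "c \<in> charts_at G (\<gamma> t)" for t c
  proof -
    have tl: "t \<in> {0..l}" "{0..s} \<subseteq> {0..l}" using s t by auto
    show ?thesis
      unfolding tscale_def
      by (rule has_vector_derivative_scaleR [OF q [OF t]
            has_vector_derivative_within_subset [OF field_vderiv [OF V tl(1) c] tl(2)]])
  qed
  show "differentiable_field G {0..s} \<gamma> (\<lambda>t. tscale (q t) (V t))"
    unfolding differentiable_field_def
  proof (intro ballI conjI)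
    fix t assume t: "t \<in> {0..s}"
    then have "t \<in> {0..l}" using s by auto
    then show "tscale (q t) (V t) \<in> tangent_space G (\<gamma> t)"
      using tscale_in_tangent_space [OF G] field_tangent [OF V] by blast
    show "(\<lambda>s. tscale (q s) (V s) c) differentiable (at t within {0..s})"
      if "c \<in> charts_at G (\<gamma> t)" for c
      by (rule differentiableI_vector [OF vderiv [OF t that]])
  qed
  assume t: "t \<in> {0..s}"
  show "cov_deriv G {0..s} \<gamma> (\<lambda>t. tscale (q t) (V t)) t
      = tadd (tscale (q' t) (V t)) (tscale (q t) (D V t))"
  proof
    fix c
    show "cov_deriv G {0..s} \<gamma> (\<lambda>t. tscale (q t) (V t)) t c
      = tadd (tscale (q' t) (V t)) (tscale (q t) (D V t)) c"
    proof (cases "c \<in> charts_at G (\<gamma> t)")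
      case True
      from cov_deriv_restrict_eq [where V = "\<lambda>t. tscale (q t) (V t)", OF s t True vderiv [OF t True]]
      show ?thesis
        using riemannian_chart.christoffel_scale [OF riemannian_chart_at [OF G True] coord_in_X [OF G True]]
        by (simp add: tadd_def tscale_def scaleR_diff_right)
    next
      case False
      have "t \<in> {0..l}" using s t by auto
      from field_tangent [OF V this] have "V t c = 0"
        using False unfolding tangent_space_def by blast
      with False show ?thesis by (simp add: cov_deriv_def tadd_def tscale_def)
    qed
  qed
qed

end

section \<open>Families of normal Jacobi fields\<close>

lemma det_scaleR: "det (r *\<^sub>R A) = r ^ CARD('n) * det A" for A :: "real^'n^'n"
proof -
  have "r *\<^sub>R A = matrix ((*\<^sub>R) r) ** A"
    by (simp add: vec_eq_iff matrix_matrix_mult_def matrix_def axis_def if_distrib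
        [of "\<lambda>x. r * x * _"] if_distrib [of "\<lambda>x. x * _"] if_distrib [of "(*) r"] cong: if_cong)
  then show ?thesis by (simp add: det_mul)
qed

locale jacobi_family = geodesic_segment G \<gamma> l
  for G :: "('m::{t2_space, second_countable_topology}, 'n::finite) riem"
    and \<gamma> :: "real \<Rightarrow> 'm" and l :: real +
  fixes V :: "'i::finite \<Rightarrow> real \<Rightarrow> ('m, 'n) tvec" and \<mu> :: real
  assumes jacobi: "\<And>i. jacobi_field G {0..l} \<gamma> (V i)"
    and orth: "\<And>i t. t \<in> {0..l} \<Longrightarrow> ip G (\<gamma> t) (T t) (V i t) = 0"
    and init: "\<And>i. D (V i) 0 = tscale \<mu> (V i 0)"
begin

lemma V_field: "field (V i)" and DV_field: "field (D (V i))"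
  using jacobi_field_D [OF jacobi] by auto

lemma V_tangent: "t \<in> {0..l} \<Longrightarrow> V i t \<in> tangent_space G (\<gamma> t)"
  and DV_tangent: "t \<in> {0..l} \<Longrightarrow> D (V i) t \<in> tangent_space G (\<gamma> t)"
  and T_tangent: "t \<in> {0..l} \<Longrightarrow> T t \<in> tangent_space G (\<gamma> t)"
  using field_tangent [OF V_field] field_tangent [OF DV_field] field_tangent [OF T_field] by auto

text \<open>
  The evolution of the family is described by scalar functions: the scalar products of the fields
  and of their derivatives, and the curvature form.
\<close>

definition Gr :: "'i \<Rightarrow> 'i \<Rightarrow> real \<Rightarrow> real" where "Gr i j t = ip G (\<gamma> t) (V i t) (V j t)"
definition H :: "'i \<Rightarrow> 'i \<Rightarrow> real \<Rightarrow> real" where "H i j t = ip G (\<gamma> t) (V i t) (D (V j) t)"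
definition K :: "'i \<Rightarrow> 'i \<Rightarrow> real \<Rightarrow> real" where "K i j t = ip G (\<gamma> t) (D (V i) t) (D (V j) t)"
definition Rm :: "'i \<Rightarrow> 'i \<Rightarrow> real \<Rightarrow> real" where
  "Rm i j t = ip G (\<gamma> t) (curv G (\<gamma> t) (V i t) (T t) (T t)) (V j t)"

lemma Gr_sym: "Gr i j t = Gr j i t" and K_sym: "K i j t = K j i t" and Rm_sym: "Rm i j t = Rm j i t"
  unfolding Gr_def K_def Rm_def by (rule ip_sym [OF G] ip_curv_sym [OF G])+

lemma H_deriv:
  assumes t: "t \<in> {0..l}"
  shows "(H i j has_real_derivative K i j t - Rm i j t) (at t within {0..l})"
  using ip_deriv [OF V_field [of i] DV_field [of j] t] jacobi_field_D(3) [OF jacobi t, of j]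
    Rm_sym [of i j t]
  by (simp add: H_def [abs_def] K_def Rm_def ip_scale [OF G] ip_sym [OF G, of _ _ "V i t"])

text \<open>
  The Wronskian of two Jacobi fields is constant, and it vanishes initially since both derivatives
  are the same multiple \<open>\<mu>\<close> of the fields. So the family is Lagrangian.
\<close>

lemma H_sym:
  assumes t: "t \<in> {0..l}"
  shows "H i j t = H j i t"
proof -
  have "((\<lambda>t. H i j t - H j i t) has_real_derivative 0) (at s within {0..l})" if "s \<in> {0..l}" for s
    using DERIV_diff [OF H_deriv [OF that, of i j] H_deriv [OF that, of j i]]
    by (simp add: K_sym [of i j] Rm_sym [of i j])
  then obtain c where c: "\<And>s. s \<in> {0..l} \<Longrightarrow> H i j s - H j i s = c"
    using has_field_derivative_zero_constant [of "{0..l}" "\<lambda>t. H i j t - H j i t"] by auto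
  have "H i j 0 - H j i 0 = 0"
    by (simp add: H_def init ip_scale [OF G] ip_sym [OF G, of _ "V i 0" "V j 0"])
  with c [of 0] c [OF t] l show ?thesis by simp
qed

lemma Gr_deriv:
  assumes t: "t \<in> {0..l}"
  shows "(Gr i j has_real_derivative 2 * H i j t) (at t within {0..l})"
  using ip_deriv [OF V_field [of i] V_field [of j] t] H_sym [OF t, of i j]
  by (simp add: Gr_def [abs_def] H_def ip_sym [OF G, of _ "D (V i) t"])

lemma initial: "H i j 0 = \<mu> * Gr i j 0" "K i j 0 = \<mu>\<^sup>2 * Gr i j 0"
  by (simp_all add: H_def K_def Gr_def init ip_scale [OF G] power2_eq_square)

lemma DV_orth:
  assumes t: "t \<in> {0..l}"
  shows "ip G (\<gamma> t) (T t) (D (V i) t) = 0"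
proof -
  have "((\<lambda>s. ip G (\<gamma> s) (T s) (V i s)) has_real_derivative ip G (\<gamma> t) (T t) (D (V i) t))
      (at t within {0..l})"
    using ip_deriv [OF T_field V_field [of i] t] by (simp add: T_parallel [OF t] ip_zero [OF G])
  moreover have "((\<lambda>s. ip G (\<gamma> s) (T s) (V i s)) has_real_derivative 0) (at t within {0..l})"
    unfolding has_field_derivative_def
    by (rule has_derivative_transform [OF t, of _ "\<lambda>_. 0"])
      (use orth DERIV_const [of 0, unfolded has_field_derivative_def] in simp_all)
  ultimately show ?thesis
    using real_derivative_unique_within_interval l t by blast
qed

text \<open>
  The hypothesis says \<open>Gr' / Gr = 2 f' / f\<close> with \<open>f = warp k \<mu>\<close>, but stays meaningful where \<open>Gr\<close> vanishes. It
  serves twice: in the space form, and in the equality case under a Ricci bound.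
\<close>

lemma Gr_scaling:
  assumes s: "s \<le> l" and pos: "\<And>t. t \<in> {0..s} \<Longrightarrow> 0 < warp k \<mu> t"
    and log_deriv: "\<And>t. t \<in> {0..s} \<Longrightarrow> warp k \<mu> t * H i j t = warp' k \<mu> t * Gr i j t"
    and t: "t \<in> {0..s}"
  shows "Gr i j t = (warp k \<mu> t)\<^sup>2 * Gr i j 0"
proof -
  have "((\<lambda>t. Gr i j t / (warp k \<mu> t)\<^sup>2) has_real_derivative 0) (at r within {0..s})"
    if r: "r \<in> {0..s}" for r
  proof -
    have 1: "(Gr i j has_real_derivative 2 * H i j r) (at r within {0..s})"
      using Gr_deriv [of r i j] r s by (auto intro: has_field_derivative_subset)
    have 2: "((\<lambda>t. (warp k \<mu> t)\<^sup>2) has_real_derivative 2 * warp k \<mu> r * warp' k \<mu> r)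
        (at r within {0..s})"
      by (auto intro!: derivative_eq_intros warp_deriv)
    have 3: "2 * H i j r * (warp k \<mu> r)\<^sup>2 - Gr i j r * (2 * warp k \<mu> r * warp' k \<mu> r) = 0"
      using arg_cong [OF log_deriv [OF r], of "\<lambda>x. 2 * warp k \<mu> r * x"]
      by (simp add: power2_eq_square algebra_simps)
    show ?thesis
      by (rule DERIV_cong [OF DERIV_divide [OF 1 2]]) (use 3 pos [OF r] in auto)
  qed
  then obtain c where c: "\<And>r. r \<in> {0..s} \<Longrightarrow> Gr i j r / (warp k \<mu> r)\<^sup>2 = c"
    using has_field_derivative_zero_constant [of "{0..s}" "\<lambda>t. Gr i j t / (warp k \<mu> t)\<^sup>2"] by auto
  from c [of 0] c [OF t] t pos [OF t] show ?thesis by (simp add: field_simps)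
qed

text \<open>
  In constant curvature \<open>R(\<cdot>, T) T\<close> is \<open>k\<close> times the identity on normal vectors, so \<open>V\<close> and \<open>f = warp k \<mu>\<close>
  satisfy the same linear equation with the same initial logarithmic derivative. Instead of
  comparing \<open>V\<close> with a parallel field, whose existence would need the theory of linear differential
  equations, consider \<open>Y = f V' - f' V\<close>: its squared length \<open>y\<close> has derivative zero and starts at zero.
\<close>

lemma Gr_constant_curvature:
  assumes k: "constant_curvature G k" and pos: "\<And>t. t \<in> {0..l} \<Longrightarrow> 0 < warp k \<mu> t"
    and t: "t \<in> {0..l}"
  shows "Gr i j t = (warp k \<mu> t)\<^sup>2 * Gr i j 0"
proof (rule Gr_scaling [OF order_refl pos _ t])
  have diag: "ip G (\<gamma> t) (curv G (\<gamma> t) u (T t) (T t)) u = k * ip G (\<gamma> t) u u"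
    if t: "t \<in> {0..l}" and u: "u \<in> tangent_space G (\<gamma> t)" "ip G (\<gamma> t) (T t) u = 0" for t u
  proof (cases "u = tzero")
    case True
    then show ?thesis by (simp add: ip_zero [OF G])
  next
    case False
    have "ip G (\<gamma> t) u (T t) = 0" using u(2) ip_sym [OF G, of "\<gamma> t"] by metis
    then have "sect_curv G (\<gamma> t) u (T t)
        = ip G (\<gamma> t) (curv G (\<gamma> t) u (T t) (T t)) u / ip G (\<gamma> t) u u"
      by (simp add: sect_curv_def T_unit [OF t])
    moreover have "sect_curv G (\<gamma> t) u (T t) = k"
      using k u T_tangent [OF t] ip_pos [OF G u(1) False] \<open>ip G (\<gamma> t) u (T t) = 0\<close> T_unit [OF t]
      unfolding constant_curvature_def by simp
    ultimately show ?thesis using ip_pos [OF G u(1) False] by (simp add: field_simps)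
  qed
  \<comment> \<open>Polarization is needed because the sectional curvature only sees the diagonal of the curvature form.\<close>
  have polar: "ip G (\<gamma> t) (curv G (\<gamma> t) u (T t) (T t)) v = k * ip G (\<gamma> t) u v"
    if t: "t \<in> {0..l}" and u: "u \<in> tangent_space G (\<gamma> t)" "ip G (\<gamma> t) (T t) u = 0"
      and v: "v \<in> tangent_space G (\<gamma> t)" "ip G (\<gamma> t) (T t) v = 0" for t u v
  proof -
    let ?b = "\<lambda>b. if b then u else v"
    have add: "tadd u v = tcomb (\<lambda>_. 1) ?b" by (simp add: tadd_def tcomb_def UNIV_bool add.commute)
    have "ip G (\<gamma> t) (T t) (tadd u v) = 0" by (simp add: ip_add_right [OF G] u v)
    from diag [OF t tadd_in_tangent_space [OF G u(1) v(1)] this]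
    have "ip G (\<gamma> t) (curv G (\<gamma> t) u (T t) (T t)) u + ip G (\<gamma> t) (curv G (\<gamma> t) v (T t) (T t)) v
        + ip G (\<gamma> t) (curv G (\<gamma> t) u (T t) (T t)) v + ip G (\<gamma> t) (curv G (\<gamma> t) v (T t) (T t)) u
        = k * (ip G (\<gamma> t) u u + ip G (\<gamma> t) v v + ip G (\<gamma> t) u v + ip G (\<gamma> t) v u)"
      unfolding add curv_tcomb [OF G]
      by (simp add: ip_tcomb_left [OF G] ip_tcomb_right [OF G] UNIV_bool algebra_simps)
    then show ?thesis
      using diag [OF t u] diag [OF t v] ip_curv_sym [OF G, of "\<gamma> t" v "T t" u] ip_sym [OF G, of "\<gamma> t" v u]
      by (simp add: algebra_simps)
  qed
  let ?f = "warp k \<mu>" and ?f' = "warp' k \<mu>"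
  fix t assume t: "t \<in> {0..l}"
  define y where "y s = (?f s)\<^sup>2 * K j j s - 2 * ?f s * ?f' s * H j j s + (?f' s)\<^sup>2 * Gr j j s" for s
  have "(y has_real_derivative 0) (at s within {0..l})" if s: "s \<in> {0..l}" for s
  proof -
    have Rm: "Rm j j s = k * Gr j j s"
      unfolding Rm_def Gr_def by (rule polar [OF s V_tangent [OF s] orth [OF s] V_tangent [OF s] orth [OF s]])
    have "ip G (\<gamma> s) (curv G (\<gamma> s) (V j s) (T s) (T s)) (D (V j) s) = k * H j j s"
      unfolding H_def
      by (rule polar [OF s V_tangent [OF s] orth [OF s] DV_tangent [OF s] DV_orth [OF s]])
    then have K': "(K j j has_real_derivative - 2 * k * H j j s) (at s within {0..l})"
      using ip_deriv [OF DV_field [of j] DV_field [of j] s]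
      by (simp add: K_def [abs_def] jacobi_field_D(3) [OF jacobi s] ip_scale [OF G]
          ip_sym [OF G, of _ "D (V j) s"] mult.assoc)
    show ?thesis
      unfolding y_def [abs_def]
      by (auto intro!: derivative_eq_intros warp_deriv warp'_deriv H_deriv [OF s] Gr_deriv [OF s] K'
          simp: Rm power2_eq_square algebra_simps)
  qed
  then obtain c where c: "\<And>s. s \<in> {0..l} \<Longrightarrow> y s = c"
    using has_field_derivative_zero_constant [of "{0..l}" y] by auto
  have "y 0 = 0" by (simp add: y_def initial power2_eq_square algebra_simps)
  with c [of 0] c [OF t] l have y0: "y t = 0" by simp
  define Y where "Y = tadd (tscale (?f t) (D (V j) t)) (tscale (- ?f' t) (V j t))"
  have Y_tangent: "Y \<in> tangent_space G (\<gamma> t)"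
    unfolding Y_def by (intro tadd_in_tangent_space [OF G] tscale_in_tangent_space [OF G] V_tangent DV_tangent t)
  have "ip G (\<gamma> t) Y Y = y t"
    by (simp add: Y_def y_def K_def H_def Gr_def ip_add_left [OF G] ip_add_right [OF G] ip_scale [OF G]
        ip_sym [OF G, of _ "D (V j) t" "V j t"] power2_eq_square algebra_simps)
  then have "Y = tzero" using ip_pos [OF G Y_tangent] y0 by force
  then have "ip G (\<gamma> t) Y (V i t) = 0" by (simp add: ip_zero [OF G])
  then show "?f t * H i j t = ?f' t * Gr i j t"
    by (simp add: Y_def H_def Gr_def ip_add_right [OF G] ip_scale [OF G]
        ip_sym [OF G, of _ _ "V i t"])
qed

definition Gram :: "real \<Rightarrow> real^'i^'i" where "Gram t = (\<chi> i j. Gr i j t)"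

lemma wedge_norm_eq: "wedge_norm G (\<gamma> t) (\<lambda>i. V i t) = sqrt (det (Gram t))"
  by (simp add: wedge_norm_def Gram_def Gr_def)

lemma wedge_norm_constant_curvature:
  assumes k: "constant_curvature G k" and pos: "\<And>t. t \<in> {0..l} \<Longrightarrow> 0 < warp k \<mu> t"
    and t: "t \<in> {0..l}"
  shows "wedge_norm G (\<gamma> t) (\<lambda>i. V i t)
    = warp k \<mu> t ^ CARD('i) * wedge_norm G (\<gamma> 0) (\<lambda>i. V i 0)"
proof -
  have "Gr i j t = (warp k \<mu> t)\<^sup>2 * Gr i j 0" for i j
    by (rule Gr_constant_curvature [OF k pos t])
  then have "Gram t = (warp k \<mu> t)\<^sup>2 *\<^sub>R Gram 0"
    by (simp add: Gram_def vec_eq_iff)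
  moreover have "((warp k \<mu> t)\<^sup>2) ^ CARD('i) = (warp k \<mu> t ^ CARD('i))\<^sup>2"
    by (simp add: mult.commute flip: power_mult)
  ultimately show ?thesis
    using pos [OF t] by (simp add: wedge_norm_eq det_scaleR real_sqrt_mult)
qed

lemma Gram_mult_vec: "(Gram t *v b) $ i = ip G (\<gamma> t) (V i t) (tcomb (\<lambda>j. b $ j) (\<lambda>j. V j t))"
  by (simp add: Gram_def Gr_def matrix_vector_mult_def ip_tcomb_right [OF G] mult.commute)

lemma independent_0:
  assumes vol0: "0 < wedge_norm G (\<gamma> 0) (\<lambda>i. V i 0)"
    and a: "tcomb a (\<lambda>i. V i 0) = tzero"
  shows "a = (\<lambda>_. 0)"
proof -
  have "invertible (Gram 0)"
    using vol0 by (simp add: wedge_norm_eq invertible_det_nz)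
  moreover have "Gram 0 *v (\<chi> i. a i) = 0"
    by (simp add: vec_eq_iff Gram_mult_vec a ip_zero [OF G])
  ultimately have "(\<chi> i. a i) = 0"
    by (metis invertible_left_inverse matrix_left_invertible_ker)
  then show ?thesis by (simp add: vec_eq_iff fun_eq_iff)
qed

lemma norm_0_pos:
  assumes vol0: "0 < wedge_norm G (\<gamma> 0) (\<lambda>i. V i 0)"
  shows "0 < tnorm G (\<gamma> 0) (V i 0)"
proof -
  have "V i 0 \<noteq> tzero"
  proof
    let ?a = "\<lambda>j. if j = i then 1 else (0 :: real)"
    assume "V i 0 = tzero"
    then have "tcomb ?a (\<lambda>i. V i 0) = tzero"
      by (simp add: tcomb_def fun_eq_iff tzero_def if_distrib [of "\<lambda>x. x *\<^sub>R _"] cong: if_cong)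
    from fun_cong [OF independent_0 [OF vol0 this], of i] show False by simp
  qed
  then show ?thesis using ip_pos [OF G V_tangent, of 0 i] l by (simp add: tnorm_def)
qed

lemma norm_constant_curvature:
  assumes k: "constant_curvature G k" and pos: "\<And>t. t \<in> {0..l} \<Longrightarrow> 0 < warp k \<mu> t"
    and t: "t \<in> {0..l}"
  shows "tnorm G (\<gamma> t) (V i t) = warp k \<mu> t * tnorm G (\<gamma> 0) (V i 0)"
proof -
  have "Gr i i t = (warp k \<mu> t)\<^sup>2 * Gr i i 0"
    by (rule Gr_constant_curvature [OF k pos t])
  then show ?thesis using pos [OF t] by (simp add: tnorm_def Gr_def real_sqrt_mult)
qed

end

section \<open>Families without focal points under a Ricci bound\<close>

locale unfocused_jacobi_family = jacobi_family G \<gamma> l V \<mu>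
  for G :: "('m::{t2_space, second_countable_topology}, 'n::finite) riem"
    and \<gamma> :: "real \<Rightarrow> 'm" and l :: real
    and V :: "'i::finite \<Rightarrow> real \<Rightarrow> ('m, 'n) tvec" and \<mu> :: real +
  fixes k :: real
  assumes dim: "CARD('n) = CARD('i) + 1"
    and Ric: "Ric_ge G ((real CARD('n) - 1) * k)"
    and vol0: "0 < wedge_norm G (\<gamma> 0) (\<lambda>i. V i 0)"
    and no_focal: "\<And>t. t \<in> {0<..l} \<Longrightarrow> \<not> focal_point G \<gamma> (tscale \<mu>) t"
begin

lemma Gram_form:
  "b \<bullet> (Gram t *v b)
    = ip G (\<gamma> t) (tcomb (\<lambda>j. b $ j) (\<lambda>j. V j t)) (tcomb (\<lambda>j. b $ j) (\<lambda>j. V j t))"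
  by (subst ip_tcomb_left [OF G]) (simp add: inner_vec_def Gram_mult_vec)

lemma Gram_sym: "transpose (Gram t) = Gram t"
  by (simp add: Gram_def transpose_def vec_eq_iff Gr_sym)

text \<open>
  A linear combination that vanishes at \<open>t\<close> is a Jacobi field which does not vanish at \<open>0\<close> and satisfies
  the initial condition for \<open>\<mu>\<close>, hence exhibits \<open>\<gamma> t\<close> as a focal point.
\<close>

lemma independent:
  assumes t: "t \<in> {0..l}" and a: "tcomb a (\<lambda>i. V i t) = tzero"
  shows "a = (\<lambda>_. 0)"
proof (rule ccontr)
  assume ne: "a \<noteq> (\<lambda>_. 0)"
  then have "t \<noteq> 0" using independent_0 [OF vol0] a by blast
  then have t': "0 < t" "t \<le> l" using t by auto
  have "cov_deriv G {0..t} \<gamma> (\<lambda>t. tcomb a (\<lambda>i. V i t)) 0 = tcomb a (\<lambda>i. D (V i) 0)"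
    by (rule cov_deriv_tcomb [OF V_field t']) (use t' in simp)
  also have "\<dots> = tscale \<mu> (tcomb a (\<lambda>i. V i 0))"
    unfolding init by (simp add: tcomb_def tscale_def scaleR_sum_right mult.commute)
  finally have "focal_point G \<gamma> (tscale \<mu>) t"
    unfolding focal_point_def
    using jacobi_field_combination [OF jacobi t', of a] a independent_0 [OF vol0, of a] ne
    by (intro exI [of _ "\<lambda>t. tcomb a (\<lambda>i. V i t)"]) auto
  then show False using no_focal t' by auto
qed

lemma Gram_pos:
  assumes t: "t \<in> {0..l}" and b: "b \<noteq> 0"
  shows "0 < b \<bullet> (Gram t *v b)"
  unfolding Gram_form
proof (rule ip_pos [OF G tcomb_in_tangent_space [OF G V_tangent [OF t]]])
  show "tcomb (\<lambda>j. b $ j) (\<lambda>j. V j t) \<noteq> tzero"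
    using independent [OF t, of "\<lambda>j. b $ j"] b by (auto simp: vec_eq_iff fun_eq_iff)
qed

lemma det_Gram_pos:
  assumes t: "t \<in> {0..l}"
  shows "0 < det (Gram t)"
proof -
  obtain Q :: "real^'i^'i" where "invertible Q" "Gram t = Q ** transpose Q"
    by (rule positive_definite_factorization [OF Gram_sym Gram_pos [OF t]])
  then have "det (Gram t) = det Q * det Q" "det Q \<noteq> 0"
    by (simp_all add: det_mul invertible_det_nz)
  then show ?thesis by (auto simp: zero_less_mult_iff linorder_neq_iff)
qed

lemma Gram_invertible: "t \<in> {0..l} \<Longrightarrow> invertible (Gram t)"
  using det_Gram_pos by (simp add: invertible_det_nz less_imp_neq [symmetric])

text \<open>
  The matrix with \<open>V\<^sub>i' = \<Sum>\<^sub>j A\<^sub>i\<^sub>j V\<^sub>j\<close>, the product of \<open>H\<close> with the inverse of \<open>Gram\<close>. It represents the shape operator of the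
  wavefronts, written in the moving frame. The rows solve linear systems with matrix \<open>Gram\<close>, in a
  form that gives differentiability in \<open>t\<close>.
\<close>

definition A :: "real \<Rightarrow> real^'i^'i" where
  "A t = (\<chi> i. matrix_inv (Gram t) *v (\<chi> j. H i j t))"

lemma A_Gram:
  assumes t: "t \<in> {0..l}"
  shows "(\<Sum>r\<in>UNIV. A t $ i $ r * Gr r j t) = H i j t" "A t ** Gram t = (\<chi> i j. H i j t)"
proof -
  have *: "(\<Sum>r\<in>UNIV. A t $ i $ r * Gr r j t) = H i j t" for i j
  proof -
    have "Gram t *v (A t $ i) = (\<chi> j. H i j t)"
      by (simp add: A_def matrix_inv_mult_vec [OF Gram_invertible [OF t]])
    then have "(Gram t *v (A t $ i)) $ j = H i j t" by simp
    then show ?thesis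
      by (simp add: matrix_vector_mult_def Gram_def Gr_sym [of j] mult.commute)
  qed
  then show "(\<Sum>r\<in>UNIV. A t $ i $ r * Gr r j t) = H i j t" .
  show "A t ** Gram t = (\<chi> i j. H i j t)"
    by (simp add: vec_eq_iff matrix_matrix_mult_def Gram_def *)
qed

lemma orthogonal_to_family:
  assumes t: "t \<in> {0..l}" and "ip G (\<gamma> t) w (T t) = 0" "\<And>i. ip G (\<gamma> t) w (V i t) = 0"
  shows "w (chart_at G (\<gamma> t)) = 0"
  by (rule orthogonal_to_frame [OF G dim T_unit [OF t] orth [OF t] V_tangent [OF t]
        independent [OF t] assms(2,3)])

text \<open>
  The difference of both sides is orthogonal to every \<open>V\<^sub>j\<close> by the choice of \<open>A\<close>, and to the velocity because
  \<open>V\<^sub>i\<close> stays normal. Velocity and \<open>V\<^sub>j\<close> together span the tangent space.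
\<close>

lemma DV_eq:
  assumes t: "t \<in> {0..l}"
  shows "D (V i) t = tcomb (\<lambda>j. A t $ i $ j) (\<lambda>j. V j t)"
proof (rule tangent_space_eqI [OF G chart_at_in [OF G] DV_tangent [OF t]
      tcomb_in_tangent_space [OF G V_tangent [OF t]]])
  let ?w = "tadd (D (V i) t) (tscale (-1) (tcomb (\<lambda>j. A t $ i $ j) (\<lambda>j. V j t)))"
  have "?w (chart_at G (\<gamma> t)) = 0"
  proof (rule orthogonal_to_family [OF t])
    show "ip G (\<gamma> t) ?w (T t) = 0"
      using ip_sym [OF G, of _ ?w "T t"]
      by (simp add: ip_add_right [OF G] ip_scale [OF G] ip_tcomb_right [OF G]
          DV_orth [OF t] orth [OF t])
    show "ip G (\<gamma> t) ?w (V j t) = 0" for j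
      using A_Gram(1) [OF t, of i j] H_sym [OF t, of i j]
      by (simp add: ip_add_left [OF G] ip_scale [OF G] ip_tcomb_left [OF G] Gr_def H_def
          ip_sym [OF G, of _ "D (V i) t"])
  qed
  then show "D (V i) t (chart_at G (\<gamma> t))
      = tcomb (\<lambda>j. A t $ i $ j) (\<lambda>j. V j t) (chart_at G (\<gamma> t))"
    by (simp add: tadd_def tscale_def)
qed

lemma K_eq: "t \<in> {0..l} \<Longrightarrow> K i j t = (\<Sum>r\<in>UNIV. A t $ i $ r * H r j t)"
  unfolding K_def by (subst DV_eq) (simp_all add: ip_tcomb_left [OF G] H_def)

definition A' :: "real \<Rightarrow> real^'i^'i" where
  "A' t = (\<chi> i j. vector_derivative (\<lambda>s. A s $ i $ j) (at t within {0..l}))"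

lemma A_deriv:
  assumes t: "t \<in> {0..l}"
  shows "((\<lambda>s. A s $ i $ j) has_real_derivative A' t $ i $ j) (at t within {0..l})"
proof -
  have "Gram differentiable (at t within {0..l})"
    using Gr_deriv [OF t] unfolding Gram_def [abs_def]
    by (intro differentiable_vec_componentwise)
      (auto simp: has_field_derivative_def intro: differentiableI)
  moreover have "(\<lambda>s. \<chi> j. H i j s) differentiable (at t within {0..l})"
    using H_deriv [OF t]
    by (intro differentiable_vec_componentwise)
      (auto simp: has_field_derivative_def intro: differentiableI)
  ultimately have "(\<lambda>s. matrix_inv (Gram s) *v (\<chi> j. H i j s)) differentiable (at t within {0..l})"
    by (rule differentiable_matrix_inv_mult_vec [OF _ _ Gram_invertible t])
  then obtain d where "((\<lambda>s. matrix_inv (Gram s) *v (\<chi> j. H i j s)) has_derivative d) (at t within {0..l})"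
    unfolding differentiable_def by blast
  from bounded_linear.has_derivative [OF bounded_linear_vec_nth this, of j]
  have "(\<lambda>s. A s $ i $ j) differentiable (at t within {0..l})"
    by (simp add: A_def differentiableI)
  then show ?thesis
    by (simp add: A'_def has_real_derivative_iff_has_vector_derivative vector_derivative_works)
qed

text \<open>
  Differentiate \<open>A Gram = H\<close> and use \<open>Gram' = 2 H\<close>, \<open>H' = K - Rm\<close> and \<open>K = A H\<close>. The result is the Riccati
  equation \<open>A' + A\<^sup>2 + R = 0\<close> in the frame, where \<open>R\<close> is the Jacobi operator.
\<close>

lemma matrix_riccati:
  assumes t: "t \<in> {0..l}"
  shows "Rm i j t = - (\<Sum>r\<in>UNIV. (A' t + A t ** A t) $ i $ r * Gr r j t)"
proof -
  have "((\<lambda>s. \<Sum>r\<in>UNIV. A s $ i $ r * Gr r j s) has_real_derivative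
      (\<Sum>r\<in>UNIV. A' t $ i $ r * Gr r j t + 2 * H r j t * A t $ i $ r)) (at t within {0..l})"
    by (intro DERIV_sum DERIV_mult A_deriv Gr_deriv t)
  then have "(H i j has_real_derivative
      (\<Sum>r\<in>UNIV. A' t $ i $ r * Gr r j t + 2 * H r j t * A t $ i $ r)) (at t within {0..l})"
    unfolding has_field_derivative_def
    by (rule has_derivative_transform [OF t, rotated]) (simp add: A_Gram)
  from real_derivative_unique_within_interval [OF this H_deriv [OF t] l t]
  have "K i j t - Rm i j t = (\<Sum>r\<in>UNIV. A' t $ i $ r * Gr r j t) + 2 * K i j t"
    by (simp add: sum.distrib K_eq [OF t] sum_distrib_left mult.commute mult.left_commute)
  moreover have "(\<Sum>r\<in>UNIV. (A t ** A t) $ i $ r * Gr r j t) = K i j t"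
  proof -
    have "(\<Sum>r\<in>UNIV. (A t ** A t) $ i $ r * Gr r j t) = (A t ** (A t ** Gram t)) $ i $ j"
      unfolding matrix_mul_assoc by (simp add: matrix_matrix_mult_def [of "A t ** A t"] Gram_def)
    also have "\<dots> = K i j t"
      unfolding A_Gram(2) [OF t] by (simp add: matrix_matrix_mult_def K_eq [OF t])
    finally show ?thesis .
  qed
  ultimately show ?thesis by (simp add: distrib_right sum.distrib)
qed

text \<open>
  The trace of the matrix Riccati equation; it computes the Ricci curvature since the \<open>V\<^sub>i\<close> and the
  velocity form a basis.
\<close>

lemma Ric_trace:
  assumes t: "t \<in> {0..l}"
  shows "Ric G (\<gamma> t) (T t) (T t) = - trace (A' t) - trace (A t ** A t)"
proof -
  let ?N = "\<lambda>i j. - (A' t + A t ** A t) $ i $ j"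
  have "curv G (\<gamma> t) (V i t) (T t) (T t) (chart_at G (\<gamma> t))
      = tcomb (?N i) (\<lambda>j. V j t) (chart_at G (\<gamma> t))" for i
  proof -
    let ?w = "tadd (curv G (\<gamma> t) (V i t) (T t) (T t)) (tscale (-1) (tcomb (?N i) (\<lambda>j. V j t)))"
    have "?w (chart_at G (\<gamma> t)) = 0"
    proof (rule orthogonal_to_family [OF t])
      show "ip G (\<gamma> t) ?w (T t) = 0"
        by (simp add: ip_add_left [OF G] ip_scale [OF G] ip_tcomb_left [OF G]
            ip_curv_tangential [OF G] ip_sym [OF G, of _ "V _ t" "T t"] orth [OF t])
      show "ip G (\<gamma> t) ?w (V j t) = 0" for j
        using matrix_riccati [OF t, of i j]
        by (simp add: ip_add_left [OF G] ip_scale [OF G] ip_tcomb_left [OF G] Gr_def Rm_def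
            algebra_simps sum.distrib sum_negf sum_subtractf)
    qed
    then show ?thesis by (simp add: tadd_def tscale_def)
  qed
  from Ric_frame [OF G dim T_unit [OF t] orth [OF t] V_tangent [OF t] independent [OF t] this]
  show ?thesis by (simp add: trace_def sum_negf sum_subtractf)
qed

text \<open>
  By Liouville's formula \<open>tr A\<close> is the logarithmic derivative of the spanned volume. Taking the root of
  order \<open>n - 1\<close> turns the trace inequality into a scalar one with the constants of the space form.
  The additional factor \<open>2\<close> in the exponent is due to the volume being the root of the Gram determinant.
\<close>

definition \<phi> :: "real \<Rightarrow> real" where "\<phi> t = trace (A t) / real CARD('i)"
definition \<phi>' :: "real \<Rightarrow> real" where "\<phi>' t = trace (A' t) / real CARD('i)"
definition w :: "real \<Rightarrow> real" where "w t = det (Gram t) powr (1 / (2 * real CARD('i)))"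

lemma trace_square_A:
  assumes t: "t \<in> {0..l}"
  shows "real CARD('i) * (\<phi> t)\<^sup>2 \<le> trace (A t ** A t)"
    "trace (A t ** A t) = real CARD('i) * (\<phi> t)\<^sup>2 \<Longrightarrow> A t = mat (\<phi> t)"
proof -
  have "transpose (A t ** Gram t) = A t ** Gram t"
    using H_sym [OF t] by (simp add: A_Gram(2) [OF t] transpose_def vec_eq_iff)
  note * = trace_square_ge [OF Gram_sym Gram_pos [OF t] this]
  show "real CARD('i) * (\<phi> t)\<^sup>2 \<le> trace (A t ** A t)"
    "trace (A t ** A t) = real CARD('i) * (\<phi> t)\<^sup>2 \<Longrightarrow> A t = mat (\<phi> t)"
    using * by (simp_all add: \<phi>_def)
qed

lemma trace_riccati:
  assumes t: "t \<in> {0..l}"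
  shows "real CARD('i) * k \<le> - real CARD('i) * \<phi>' t - trace (A t ** A t)"
proof -
  have "(real CARD('n) - 1) * k \<le> Ric G (\<gamma> t) (T t) (T t)"
    using Ric T_tangent [OF t] T_unit [OF t] by (simp add: Ric_ge_def tnorm_def)
  then show ?thesis by (simp add: Ric_trace [OF t] dim \<phi>'_def)
qed

lemma w_power: "t \<in> {0..l} \<Longrightarrow> wedge_norm G (\<gamma> t) (\<lambda>i. V i t) = w t ^ CARD('i)"
  using det_Gram_pos [of t]
  by (simp add: wedge_norm_eq w_def powr_powr powr_half_sqrt flip: powr_realpow)

sublocale riccati_supersolution k \<mu> l w \<phi> \<phi>'
proof
  fix t assume t: "t \<in> {0..l}"
  note d = det_Gram_pos [OF t]
  show "0 < w t" using d by (simp add: w_def)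
  show "(\<phi> has_real_derivative \<phi>' t) (at t within {0..l})"
    unfolding \<phi>_def [abs_def] \<phi>'_def trace_def
    by (intro DERIV_cdivide DERIV_sum A_deriv t)
  have "((\<lambda>s. Gram s $ i $ j) has_real_derivative ((2 *\<^sub>R A t) ** Gram t) $ i $ j)
      (at t within {0..l})" for i j
  proof -
    have "(2 *\<^sub>R A t) ** Gram t = 2 *\<^sub>R (A t ** Gram t)"
      by (simp add: matrix_matrix_mult_def vec_eq_iff sum_distrib_left mult.assoc)
    moreover have "Gram s $ i $ j = Gr i j s" for s by (simp add: Gram_def)
    ultimately show ?thesis using Gr_deriv [OF t, of i j] by (simp add: A_Gram(2) [OF t])
  qed
  from det_has_derivative_Liouville [OF this]
  have D: "((\<lambda>s. det (Gram s)) has_real_derivative (2 * trace (A t)) * det (Gram t)) (at t within {0..l})"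
    by (simp add: trace_def sum_distrib_left)
  define r where "r = 1 / (2 * real CARD('i))"
  have w_eq: "w s = det (Gram s) powr r" for s by (simp add: w_def r_def)
  have "(w has_real_derivative (r * det (Gram t) powr (r - 1)) * (2 * trace (A t) * det (Gram t)))
      (at t within {0..l})"
    unfolding w_eq [abs_def]
    by (rule DERIV_chain' [OF D has_real_derivative_powr [OF d]])
  moreover have "(r * det (Gram t) powr (r - 1)) * (2 * trace (A t) * det (Gram t)) = \<phi> t * w t"
  proof -
    have "2 * r * trace (A t) = \<phi> t" by (simp add: r_def \<phi>_def)
    moreover have "det (Gram t) * det (Gram t) powr (r - 1) = w t"
      using powr_mult_base [of "det (Gram t)" "r - 1"] d by (simp add: w_eq)
    moreover have "(r * det (Gram t) powr (r - 1)) * (2 * trace (A t) * det (Gram t))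
        = (2 * r * trace (A t)) * (det (Gram t) * det (Gram t) powr (r - 1))"
      by (simp only: mult_ac)
    ultimately show ?thesis by metis
  qed
  ultimately show "(w has_real_derivative \<phi> t * w t) (at t within {0..l})" by simp
  have "real CARD('i) * (\<phi>' t + (\<phi> t)\<^sup>2 + k) \<le> 0"
    using trace_square_A(1) [OF t] trace_riccati [OF t] by (simp add: algebra_simps)
  then have "\<phi>' t + (\<phi> t)\<^sup>2 + k \<le> 0" by (simp add: mult_le_0_iff)
  then show "\<phi>' t \<le> - k - (\<phi> t)\<^sup>2" by simp
next
  have t: "0 \<in> {0..l}" using l by simp
  have "A 0 ** Gram 0 = mat \<mu> ** Gram 0"
    unfolding A_Gram(2) [OF t]
    by (simp add: initial vec_eq_iff matrix_matrix_mult_def mat_def Gram_def if_distrib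
        [of "\<lambda>x. x * _"] cong: if_cong)
  then have "A 0 = mat \<mu>"
    using Gram_invertible [OF t] unfolding invertible_def by (metis matrix_mul_assoc matrix_mul_rid)
  then show "\<phi> 0 = \<mu>" by (simp add: \<phi>_def trace_def mat_def)
qed

text \<open>
  Equality of volumes at \<open>t0\<close> forces equality in the scalar Riccati inequality, hence in the
  Cauchy--Schwarz inequality for \<open>A\<close>, so \<open>A\<close> is a multiple of the identity.
\<close>

lemma umbilic_of_equality:
  assumes t0: "t0 \<in> {0<..l}" and eq: "w t0 = w 0 * f t0" and t: "t \<in> {0..t0}"
  shows "D (V i) t = tscale (\<phi> t) (V i t)"
proof -
  have tl: "t \<in> {0..l}" using t t0 by auto
  have "trace (A t ** A t) \<le> real CARD('i) * (\<phi> t)\<^sup>2"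
    using trace_riccati [OF tl] by (simp add: rigidity(2) [OF t0 eq t] algebra_simps)
  then have "A t = mat (\<phi> t)" using trace_square_A [OF tl] by simp
  then show ?thesis
    by (simp add: DV_eq [OF tl] mat_def tcomb_def tscale_def if_distrib [of "\<lambda>x. x *\<^sub>R _"] cong: if_cong)
qed

lemma norm_of_equality:
  assumes t0: "t0 \<in> {0<..l}" and eq: "w t0 = w 0 * f t0" and t: "t \<in> {0..t0}"
  shows "tnorm G (\<gamma> t) (V i t) = f t * tnorm G (\<gamma> 0) (V i 0)"
proof -
  have "Gr i i t = (f t)\<^sup>2 * Gr i i 0"
  proof (rule Gr_scaling [OF _ _ _ t])
    fix s assume s: "s \<in> {0..t0}"
    then show "0 < f s" using f_pos t0 by auto
    then show "f s * H i i s = f' s * Gr i i s"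
      by (simp add: H_def Gr_def umbilic_of_equality [OF t0 eq s] ip_scale [OF G] rigidity(1) [OF t0 eq s])
  qed (use t0 in auto)
  moreover have "0 < f t" using f_pos t t0 by auto
  ultimately show ?thesis by (simp add: tnorm_def Gr_def real_sqrt_mult)
qed

text \<open>
  By the preceding results \<open>V\<^sub>i / \<parallel>V\<^sub>i\<parallel> = V\<^sub>i / (f \<parallel>V\<^sub>i(0)\<parallel>)\<close> and \<open>V\<^sub>i' = (f' / f) V\<^sub>i\<close>, so the covariant derivative of the
  quotient cancels.
\<close>

lemma parallel_of_equality:
  assumes t0: "t0 \<in> {0<..l}" and eq: "w t0 = w 0 * f t0"
  shows "parallel_field G {0..t0} \<gamma> (\<lambda>t. tscale (inverse (tnorm G (\<gamma> t) (V i t))) (V i t))"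
proof -
  let ?n = "tnorm G (\<gamma> 0) (V i 0)"
  let ?q = "\<lambda>t. inverse (f t * ?n)" and ?q' = "\<lambda>t. - (f' t * ?n) / (f t * ?n)\<^sup>2"
  have pos: "0 < f t" if "t \<in> {0..t0}" for t using f_pos that t0 by auto
  have q: "(?q has_real_derivative ?q' t) (at t within {0..t0})" if "t \<in> {0..t0}" for t
    using pos [OF that] norm_0_pos [OF vol0, of i]
    by (auto intro!: derivative_eq_intros warp_deriv simp: power2_eq_square divide_simps)
  have t0': "0 < t0" "t0 \<le> l" using t0 by auto
  have scale: "cov_deriv G {0..t0} \<gamma> (\<lambda>t. tscale (?q t) (V i t)) t
      = tadd (tscale (?q' t) (V i t)) (tscale (?q t) (D (V i) t))" if "t \<in> {0..t0}" for t
    by (rule tscale_restrict(2) [OF V_field [of i] t0' _ that]) (rule q)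
  have U: "tscale (inverse (tnorm G (\<gamma> t) (V i t))) (V i t) = tscale (?q t) (V i t)"
    if "t \<in> {0..t0}" for t
    by (simp add: norm_of_equality [OF t0 eq that])
  show ?thesis
    unfolding parallel_field_def
  proof (intro conjI ballI)
    show "differentiable_field G {0..t0} \<gamma> (\<lambda>t. tscale (inverse (tnorm G (\<gamma> t) (V i t))) (V i t))"
      by (rule differentiable_field_cong [OF tscale_restrict(1) [OF V_field [of i] t0' q] U])
    fix t assume t: "t \<in> {0..t0}"
    have "?q' t + ?q t * \<phi> t = 0"
      using pos [OF t] norm_0_pos [OF vol0, of i]
      by (simp add: rigidity(1) [OF t0 eq t] field_simps power2_eq_square)
    moreover have "cov_deriv G {0..t0} \<gamma> (\<lambda>t. tscale (inverse (tnorm G (\<gamma> t) (V i t))) (V i t)) t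
        = cov_deriv G {0..t0} \<gamma> (\<lambda>t. tscale (?q t) (V i t)) t"
      by (rule cov_deriv_cong [OF _ t]) (rule U)
    then have "cov_deriv G {0..t0} \<gamma> (\<lambda>t. tscale (inverse (tnorm G (\<gamma> t) (V i t))) (V i t)) t
        = tscale (?q' t + ?q t * \<phi> t) (V i t)"
      unfolding scale [OF t] umbilic_of_equality [OF t0 eq t]
      by (simp add: tadd_def tscale_def scaleR_add_left scaleR_diff_left fun_eq_iff)
    ultimately show "cov_deriv G {0..t0} \<gamma> (\<lambda>t. tscale (inverse (tnorm G (\<gamma> t) (V i t))) (V i t)) t = tzero"
      by (simp add: tscale_def tzero_def)
  qed
qed

text \<open>
  The equations \<open>H\<^sub>i\<^sub>i = \<phi> Gr\<^sub>i\<^sub>i\<close> and \<open>K\<^sub>i\<^sub>i = \<phi>\<^sup>2 Gr\<^sub>i\<^sub>i\<close> turn \<open>H' = K - Rm\<close> into \<open>Rm\<^sub>i\<^sub>i = - (\<phi>' + \<phi>\<^sup>2) Gr\<^sub>i\<^sub>i\<close>, and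
  the factor is \<open>k\<close> by equality in the Riccati inequality.
\<close>

lemma curvature_of_equality:
  assumes t0: "t0 \<in> {0<..l}" and eq: "w t0 = w 0 * f t0" and t: "t \<in> {0..t0}"
  shows "sect_curv G (\<gamma> t) (T t) (V i t) = k"
proof -
  have tl: "t \<in> {0..l}" using t t0 by auto
  have sub: "{0..t0} \<subseteq> {0..l}" using t0 by auto
  have H: "H i i s = \<phi> s * Gr i i s" and K: "K i i s = (\<phi> s)\<^sup>2 * Gr i i s" if "s \<in> {0..t0}" for s
    by (simp_all add: H_def K_def Gr_def umbilic_of_equality [OF t0 eq that] ip_scale [OF G] power2_eq_square)
  have "((\<lambda>s. \<phi> s * Gr i i s) has_real_derivative \<phi>' t * Gr i i t + 2 * H i i t * \<phi> t)
      (at t within {0..t0})"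
    by (intro has_field_derivative_subset [OF DERIV_mult [OF \<phi>_deriv [OF tl] Gr_deriv [OF tl]] sub])
  then have "(H i i has_real_derivative \<phi>' t * Gr i i t + 2 * H i i t * \<phi> t) (at t within {0..t0})"
    unfolding has_field_derivative_def
    by (rule has_derivative_transform [OF t, rotated]) (simp add: H)
  from real_derivative_unique_within_interval [OF this has_field_derivative_subset [OF H_deriv [OF tl] sub]]
  have "Rm i i t = k * Gr i i t"
    using t t0 by (simp add: H [OF t] K [OF t] rigidity(2) [OF t0 eq t] power2_eq_square algebra_simps)
  moreover have "0 < Gr i i t"
  proof -
    have "0 < tnorm G (\<gamma> t) (V i t)"
      using norm_of_equality [OF t0 eq t] norm_0_pos [OF vol0, of i] f_pos [OF tl] by simp
    then show ?thesis by (simp add: tnorm_def Gr_def)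
  qed
  moreover have "sect_curv G (\<gamma> t) (T t) (V i t) = Rm i i t / Gr i i t"
    by (simp add: sect_curv_def T_unit [OF tl] orth [OF tl] ip_curv_skew_both [OF G] Rm_def Gr_def)
  ultimately show ?thesis by simp
qed

end

section \<open>The volume comparison\<close>

theorem theoremD:
  fixes M :: "('m::{t2_space, second_countable_topology}, 'n::finite) riem"
    and S :: "('s::{t2_space, second_countable_topology}, 'n) riem"
    and \<gamma> :: "real \<Rightarrow> 'm" and \<gamma>S :: "real \<Rightarrow> 's"
    and V :: "'i::finite \<Rightarrow> real \<Rightarrow> ('m, 'n) tvec"
    and VS :: "'i \<Rightarrow> real \<Rightarrow> ('s, 'n) tvec"
    and k l \<mu> \<mu>S :: real
  assumes dim: "CARD('n) = CARD('i) + 1"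
    and M: "riemannian_manifold M" "Ric_ge M ((real CARD('n) - 1) * k)"
    and S: "space_form S k"
    and l: "l > 0"
    and geodesics: "normal_geodesic M {0..l} \<gamma>" "normal_geodesic S {0..l} \<gamma>S"
    and jacobi: "\<And>i. jacobi_field M {0..l} \<gamma> (V i)" "\<And>i. jacobi_field S {0..l} \<gamma>S (VS i)"
    and orth:
      "\<And>i t. t \<in> {0..l} \<Longrightarrow> ip M (\<gamma> t) (velocity M {0..l} \<gamma> t) (V i t) = 0"
      "\<And>i t. t \<in> {0..l} \<Longrightarrow> ip S (\<gamma>S t) (velocity S {0..l} \<gamma>S t) (VS i t) = 0"
    and vol0: "0 < wedge_norm M (\<gamma> 0) (\<lambda>i. V i 0)"
      "wedge_norm M (\<gamma> 0) (\<lambda>i. V i 0) \<le> wedge_norm S (\<gamma>S 0) (\<lambda>i. VS i 0)"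
    and init: "\<And>i. cov_deriv M {0..l} \<gamma> (V i) 0 = tscale \<mu> (V i 0)"
      "\<And>i. cov_deriv S {0..l} \<gamma>S (VS i) 0 = tscale \<mu>S (VS i 0)"
      "\<mu> \<le> \<mu>S"
    and no_focal: "\<And>t. t \<in> {0<..l} \<Longrightarrow> \<not> focal_point M \<gamma> (tscale \<mu>) t"
  shows "(\<forall>t\<in>{0..l}. wedge_norm S (\<gamma>S t) (\<lambda>i. VS i t) \<ge> wedge_norm M (\<gamma> t) (\<lambda>i. V i t)) \<and>
    (\<forall>t0\<in>{0<..l}.
       wedge_norm S (\<gamma>S t0) (\<lambda>i. VS i t0) = wedge_norm M (\<gamma> t0) (\<lambda>i. V i t0) \<longrightarrow>
       (\<forall>i. (\<forall>t\<in>{0..t0}. tnorm M (\<gamma> t) (V i t) / tnorm M (\<gamma> 0) (V i 0)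
                          = tnorm S (\<gamma>S t) (VS i t) / tnorm S (\<gamma>S 0) (VS i 0)) \<and>
            parallel_field M {0..t0} \<gamma> (\<lambda>t. tscale (inverse (tnorm M (\<gamma> t) (V i t))) (V i t)) \<and>
            (\<forall>t\<in>{0..t0}. sect_curv M (\<gamma> t) (velocity M {0..l} \<gamma> t) (V i t) = k)) \<and>
       \<mu> = \<mu>S)"
proof -
  interpret M: unfocused_jacobi_family M \<gamma> l V \<mu> k
    by unfold_locales (use assms in auto)
  have S': "riemannian_manifold S" "constant_curvature S k" using S by (auto simp: space_form_def)
  interpret S: jacobi_family S \<gamma>S l VS \<mu>S
    by unfold_locales (use assms S' in auto)
  let ?m = "CARD('i)"
  let ?WM = "\<lambda>t. wedge_norm M (\<gamma> t) (\<lambda>i. V i t)" and ?WS = "\<lambda>t. wedge_norm S (\<gamma>S t) (\<lambda>i. VS i t)"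
  let ?f = "warp k \<mu>" and ?fS = "warp k \<mu>S"
  have fS: "?fS t = ?f t + (\<mu>S - \<mu>) * sn k t" for t by (simp add: warp_def algebra_simps)
  have sn: "0 \<le> sn k t" if "t \<in> {0..l}" for t
    using M.sn_pos [of t] that by (cases "t = 0") auto
  have f_le: "?f t \<le> ?fS t" and f_pos: "0 < ?f t" if "t \<in> {0..l}" for t
    using sn [OF that] init(3) M.f_pos [OF that] by (simp_all add: fS)
  have fS_pos: "0 < ?fS t" if "t \<in> {0..l}" for t
    using f_le [OF that] f_pos [OF that] by simp
  have WS: "?WS t = ?fS t ^ ?m * ?WS 0" if "t \<in> {0..l}" for t
    by (rule S.wedge_norm_constant_curvature [OF S'(2) fS_pos that])
  have zero: "0 \<in> {0..l}" using l by simp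
  have w_le: "?WM t \<le> ?f t ^ ?m * ?WM 0" if t: "t \<in> {0..l}" for t
  proof -
    have "?WM t \<le> (M.w 0 * ?f t) ^ ?m"
      unfolding M.w_power [OF t]
      by (rule power_mono [OF M.comparison [OF t]]) (use M.w_pos [OF t] in simp)
    then show ?thesis by (simp add: M.w_power [OF zero] power_mult_distrib mult.commute)
  qed
  have f_power: "?f t ^ ?m * ?WM 0 \<le> ?f t ^ ?m * ?WS 0" "?f t ^ ?m * ?WS 0 \<le> ?fS t ^ ?m * ?WS 0"
    if t: "t \<in> {0..l}" for t
    using vol0 f_pos [OF t] f_le [OF t] by (auto intro!: mult_left_mono mult_right_mono power_mono)
  show ?thesis
  proof (intro conjI ballI impI allI)
    fix t assume t: "t \<in> {0..l}"
    show "?WM t \<le> ?WS t"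
      using w_le [OF t] f_power [OF t] WS [OF t] by linarith
  next
    fix t0 assume t0: "t0 \<in> {0<..l}" and eq: "?WS t0 = ?WM t0"
    have t0l: "t0 \<in> {0..l}" using t0 by auto
    \<comment> \<open>Equality of the two ends of the chain of inequalities forces equality in every link.\<close>
    have "?fS t0 ^ ?m * ?WS 0 = ?f t0 ^ ?m * ?WS 0" and w: "?WM t0 = ?f t0 ^ ?m * ?WM 0"
      using w_le [OF t0l] f_power [OF t0l] WS [OF t0l] eq by linarith+
    then have "?fS t0 ^ ?m = ?f t0 ^ ?m" using vol0 by simp
    then have "?fS t0 = ?f t0"
      by (rule power_eq_imp_eq_base) (use fS_pos [OF t0l] f_pos [OF t0l] in simp_all)
    then show \<mu>: "\<mu> = \<mu>S" using M.sn_pos [OF t0] by (simp add: fS)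
    have "M.w t0 ^ ?m = (M.w 0 * ?f t0) ^ ?m"
      using w by (simp add: M.w_power [OF t0l] M.w_power [OF zero] power_mult_distrib mult.commute)
    then have w_eq: "M.w t0 = M.w 0 * ?f t0"
      by (rule power_eq_imp_eq_base)
        (use M.w_pos [OF t0l] M.w_pos [OF zero] f_pos [OF t0l] in simp_all)
    fix i
    show "parallel_field M {0..t0} \<gamma> (\<lambda>t. tscale (inverse (tnorm M (\<gamma> t) (V i t))) (V i t))"
      by (rule M.parallel_of_equality [OF t0 w_eq])
    fix t assume t: "t \<in> {0..t0}"
    then have tl: "t \<in> {0..l}" using t0 by auto
    show "sect_curv M (\<gamma> t) (velocity M {0..l} \<gamma> t) (V i t) = k"
      by (rule M.curvature_of_equality [OF t0 w_eq t])
    have "tnorm M (\<gamma> t) (V i t) / tnorm M (\<gamma> 0) (V i 0) = ?f t"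
      using M.norm_0_pos [OF vol0(1), of i] by (simp add: M.norm_of_equality [OF t0 w_eq t])
    moreover have "tnorm S (\<gamma>S t) (VS i t) = ?fS t * tnorm S (\<gamma>S 0) (VS i 0)"
      by (rule S.norm_constant_curvature [OF S'(2) fS_pos tl])
    then have "tnorm S (\<gamma>S t) (VS i t) / tnorm S (\<gamma>S 0) (VS i 0) = ?f t"
      using S.norm_0_pos [of i] vol0 by (simp add: \<mu>)
    ultimately show "tnorm M (\<gamma> t) (V i t) / tnorm M (\<gamma> 0) (V i 0)
        = tnorm S (\<gamma>S t) (VS i t) / tnorm S (\<gamma>S 0) (VS i 0)" by simp
  qed
qed

end
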